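(* Suppose that $\ker(B)\cap V_0=\{0\}$ and let $\phi$ be a uniformly convex N-function such that $\phi'(t)/t\le\phi'(T)/T$ for all $0<t\le T$. Let $u_g=u+g$ with $u=\operatorname{argmin}_{v\in V_0}J(v+g)$. Then for every $\varepsilon>0$ there exists a relaxation interval $\delta=[\delta_-,\delta_+]\subset(0,\infty)$ such that, with $u_{\delta,g}=u_\delta+g$ and $u_\delta=\operatorname{argmin}_{v\in V_0}J_\delta(v+g)$, $$J_\delta(u_g)-J_\delta(u_{\delta,g})\le\varepsilon,$$ and there exist constants $\kappa_\delta\in(0,1)$ and $C_\delta<\infty$ depending on $\delta$ such that the iterates $u^n_g:=u^n+g$ of the dIRLS scheme applied to the regularized integrand $\phi_\delta$ with initial value $\sigma^0\in\Sigma_f$ satisfy for all $n\ge1$ $$\sum_{\alpha\in\mathcal{A}}w_\alpha\,\big|V_{\phi_\delta}((Bu_g)_\alpha)-V_{\phi_\delta}((Bu^n_g)_\alpha)\big|^2\le c\,\Big(\varepsilon+C_\delta(1-\kappa_\delta)^n\big(J^*_\delta(\sigma^0)-J^*_\delta(\sigma_\delta)\big)\Big),$$ where $\sigma_\delta=\operatorname{argmin}_{\tau\in\Sigma_f}J^*_\delta(\tau)$ and $c<\infty$ is a constant depending solely on the uniform convexity constants of $\phi$.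
   Context: N-function: $\phi:[0,\infty)\to[0,\infty)$ is an N-function if it is continuous and convex and there is a right-continuous, non-decreasing $\phi':[0,\infty)\to[0,\infty)$ with $\phi'(0)=0$, $\phi'(t)>0$ for $t>0$, $\lim_{t\to\infty}\phi'(t)=\infty$ and $\phi(t)=\int_0^t\phi'(s)\,ds$. Fenchel conjugate: $\phi^*(r):=\sup_{s\ge0}(rs-\phi(s))$, $r\ge0$. Uniform convexity: there are constants $0<k_1\le k_2<\infty$ (the uniform convexity constants) with $k_1\frac{\phi'(s)}{s}\le\frac{\phi'(t)-\phi'(s)}{t-s}\le k_2\frac{\phi'(s)}{s}$ for all $0\le t<s$. Setting: $M,N\in\mathbb{N}$, $\mathcal{A}=\{1,\dots,M\}$, $B:\mathbb{R}^N\to\mathbb{R}^M$ linear, weights $w_\alpha>0$, $f\in\mathbb{R}^N$, $C\in\mathbb{R}^{m_c\times N}$, $d\in\mathbb{R}^{m_c}$ with $m_c\in\mathbb{N}_0$, $g\in\mathbb{R}^N$ with $Cg=d$, $V_0:=\ker(C)$, and $$J(v):=\sum_{\alpha\in\mathcal{A}}w_\alpha\phi(|(Bv)_\alpha|)-f\cdot v\ (v\in\mathbb{R}^N),\qquad \Sigma_f:=\{\tau\in\mathbb{R}^M:\tau^\top Bv=f\cdot v\ \text{for all }v\in V_0\}.$$ Regularization: for $\delta=[\delta_-,\delta_+]$, $0<\delta_-\le\delta_+<\infty$, $$\phi_\delta(t):=\begin{cases}\frac{\phi'(\delta_-)}{2\delta_-}t^2+\phi(\delta_-)-\frac{\delta_-}{2}\phi'(\delta_-),&t\in[0,\delta_-),\\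 \phi(t),&t\in[\delta_-,\delta_+],\\ \frac{\phi'(\delta_+)}{2\delta_+}t^2+\phi(\delta_+)-\frac{\delta_+}{2}\phi'(\delta_+),&t\in(\delta_+,\infty),\end{cases}$$ with derivative $\phi_\delta'(t)=t\cdot\min\{\max\{\phi'(\delta_-)/\delta_-,\phi'(t)/t\},\phi'(\delta_+)/\delta_+\}$ (and $\phi_\delta'(0)=0$), and conjugate $\phi_\delta^*(r)=\sup_{s\ge0}(rs-\phi_\delta(s))$ with derivative $(\phi_\delta^* )'$. Set $$J_\delta(v):=\sum_{\alpha}w_\alpha\phi_\delta(|(Bv)_\alpha|)-f\cdot v,\qquad J^*_\delta(\tau):=\sum_\alpha w_\alpha\phi_\delta^*(w_\alpha^{-1}|\tau_\alpha|)-\tau^\top Bg .$$ Moreover $V_{\phi_\delta}(t):=\sqrt{\phi_\delta'(|t|)/|t|}\;t$ for $t\ne0$ and $V_{\phi_\delta}(0):=0$. dIRLS scheme for $\phi_\delta$: given $\sigma^n\in\mathbb{R}^M$, $n\in\mathbb{N}_0$, set $a_\alpha:=|\sigma^n_\alpha|/(\phi_\delta^* )'(w_\alpha^{-1}|\sigma^n_\alpha|)$, where for $\sigma^n_\alpha=0$ the reciprocal is interpreted as $\lim_{t\searrow0}(\phi_\delta^* )'(w_\alpha^{-1}t)/t$. Let $u^{n+1}\in V_0$ solve $$\sum_{\alpha\in\mathcal{A}}a_\alpha(B(u^{n+1}+g))_\alpha(Bv)_\alpha=f\cdot v\qquad\text{for all }v\in V_0,$$ and set $\sigma^{n+1}_\alpha:=a_\alpha(B(u^{n+1}+g))_\alpha$.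 *)

theory Defs
  imports "HOL-Analysis.Analysis" "Jordan_Normal_Form.Matrix_Kernel"
begin

no_notation inner (infix "\<bullet>" 70)
no_notation vec_nth (infixl "$" 90)

(* Vectors and matrices have explicit dimensions (Jordan_Normal_Form) rather than
   type-indexed ones, so that a constant can be quantified ahead of the dimensions.
   The index set {1,...,M} becomes {..<M} = {..<dim_row B}. *)

section \<open>N-functions and uniform convexity\<close>

(* Functions on [0,\<infinity>) are total functions on the reals whose values at negative
   arguments are irrelevant. Right-continuity and the integral formula determine the
   second argument uniquely on [0,\<infinity>). *)
definition N_function :: "(real \<Rightarrow> real) \<Rightarrow> (real \<Rightarrow> real) \<Rightarrow> bool" where
  "N_function \<phi> \<phi>' \<longleftrightarrow>
     (\<forall>t\<ge>0. 0 \<le> \<phi> t) \<and> continuous_on {0..} \<phi> \<and> convex_on {0..} \<phi> \<and>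
     (\<forall>t\<ge>0. 0 \<le> \<phi>' t) \<and> (\<forall>t\<ge>0. continuous (at_right t) \<phi>') \<and> mono_on {0..} \<phi>' \<and>
     \<phi>' 0 = 0 \<and> (\<forall>t>0. \<phi>' t > 0) \<and> filterlim \<phi>' at_top at_top \<and>
     (\<forall>t\<ge>0. (\<phi>' has_integral \<phi> t) {0..t})"

definition uniformly_convex_fun :: "real \<Rightarrow> real \<Rightarrow> (real \<Rightarrow> real) \<Rightarrow> bool" where
  "uniformly_convex_fun k1 k2 \<phi>' \<longleftrightarrow> 0 < k1 \<and> k1 \<le> k2 \<and>
     (\<forall>s t. 0 \<le> t \<and> t < s \<longrightarrow>
        k1 * (\<phi>' s / s) \<le> (\<phi>' t - \<phi>' s) / (t - s) \<and>
        (\<phi>' t - \<phi>' s) / (t - s) \<le> k2 * (\<phi>' s / s))"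

definition fenchel_conj :: "(real \<Rightarrow> real) \<Rightarrow> real \<Rightarrow> real" where
  "fenchel_conj \<phi> r = (SUP s\<in>{0..}. r * s - \<phi> s)"

section \<open>Regularized integrand on the relaxation interval [a, b]\<close>

definition phi_reg :: "(real \<Rightarrow> real) \<Rightarrow> (real \<Rightarrow> real) \<Rightarrow> real \<Rightarrow> real \<Rightarrow> real \<Rightarrow> real" where
  "phi_reg \<phi> \<phi>' a b t =
     (if t < a then \<phi>' a / (2 * a) * t\<^sup>2 + \<phi> a - a / 2 * \<phi>' a
      else if t \<le> b then \<phi> t
      else \<phi>' b / (2 * b) * t\<^sup>2 + \<phi> b - b / 2 * \<phi>' b)"

definition phi_reg' :: "(real \<Rightarrow> real) \<Rightarrow> real \<Rightarrow> real \<Rightarrow> real \<Rightarrow> real" where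
  "phi_reg' \<phi>' a b t =
     (if t = 0 then 0 else t * min (max (\<phi>' a / a) (\<phi>' t / t)) (\<phi>' b / b))"

(* V_fun \<psi>' is V_\<psi> for an integrand \<psi> with derivative \<psi>'. *)
definition V_fun :: "(real \<Rightarrow> real) \<Rightarrow> real \<Rightarrow> real" where
  "V_fun \<psi>' t = (if t = 0 then 0 else sqrt (\<psi>' \<bar>t\<bar> / \<bar>t\<bar>) * t)"

section \<open>Energies and the dual feasible set\<close>

definition primal_energy ::
    "real mat \<Rightarrow> (nat \<Rightarrow> real) \<Rightarrow> real vec \<Rightarrow> (real \<Rightarrow> real) \<Rightarrow> real vec \<Rightarrow> real" where
  "primal_energy B w f \<psi> v = (\<Sum>\<alpha><dim_row B. w \<alpha> * \<psi> \<bar>(B *\<^sub>v v) $ \<alpha>\<bar>) - f \<bullet> v"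

definition dual_energy ::
    "real mat \<Rightarrow> (nat \<Rightarrow> real) \<Rightarrow> real vec \<Rightarrow> (real \<Rightarrow> real) \<Rightarrow> real vec \<Rightarrow> real" where
  "dual_energy B w g \<psi> \<tau> =
     (\<Sum>\<alpha><dim_row B. w \<alpha> * fenchel_conj \<psi> (inverse (w \<alpha>) * \<bar>\<tau> $ \<alpha>\<bar>)) - \<tau> \<bullet> (B *\<^sub>v g)"

definition dual_feasible :: "real mat \<Rightarrow> real mat \<Rightarrow> real vec \<Rightarrow> real vec set" where
  "dual_feasible B C f =
     {\<tau> \<in> carrier_vec (dim_row B). \<forall>v\<in>mat_kernel C. \<tau> \<bullet> (B *\<^sub>v v) = f \<bullet> v}"

section \<open>The dIRLS scheme\<close>

definition dirls_weight :: "(real \<Rightarrow> real) \<Rightarrow> real \<Rightarrow> real \<Rightarrow> real" where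
  "dirls_weight \<psi> \<omega> s =
     (if s = 0
      then inverse (Lim (at_right 0) (\<lambda>t. deriv (fenchel_conj \<psi>) (inverse \<omega> * t) / t))
      else \<bar>s\<bar> / deriv (fenchel_conj \<psi>) (inverse \<omega> * \<bar>s\<bar>))"

(* \<sigma> and u are the sequences produced by the scheme; u 0 plays no role. *)
definition dirls_iterates ::
    "real mat \<Rightarrow> real mat \<Rightarrow> (nat \<Rightarrow> real) \<Rightarrow> real vec \<Rightarrow> real vec \<Rightarrow> (real \<Rightarrow> real) \<Rightarrow>
     (nat \<Rightarrow> real vec) \<Rightarrow> (nat \<Rightarrow> real vec) \<Rightarrow> bool" where
  "dirls_iterates B C w f g \<psi> \<sigma> u \<longleftrightarrow>
     (\<forall>n. let a = (\<lambda>\<alpha>. dirls_weight \<psi> (w \<alpha>) (\<sigma> n $ \<alpha>)) in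
        u (Suc n) \<in> mat_kernel C \<and>
        (\<forall>v\<in>mat_kernel C.
           (\<Sum>\<alpha><dim_row B. a \<alpha> * (B *\<^sub>v (u (Suc n) + g)) $ \<alpha> * (B *\<^sub>v v) $ \<alpha>) = f \<bullet> v) \<and>
        \<sigma> (Suc n) = vec (dim_row B) (\<lambda>\<alpha>. a \<alpha> * (B *\<^sub>v (u (Suc n) + g)) $ \<alpha>))"

end

theory Submission
  imports Defs
begin

text \<open>Write \<open>\<mu> t = \<phi>\<^sub>\<delta>' t / t\<close>; it is nondecreasing with values between \<open>m = \<phi>' a / a\<close> and
  \<open>L = \<phi>' b / b\<close>. Hence \<open>\<phi>\<^sub>\<delta>\<close> is strongly convex with modulus \<open>m\<close>. If \<open>b\<close> bounds the entries of
  \<open>B u\<^sub>g\<close>, the gradient of the regularized energy at \<open>u\<^sub>g\<close> differs from that of \<open>J\<close>, which vanishes on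
  \<open>V\<^sub>0\<close>, by at most \<open>\<phi>' a\<close> per entry, so the energy gap is at most \<open>(\<Sum> w) a \<phi>' a / 2\<close>, which tends
  to \<open>0\<close> with \<open>a\<close>.

  The conjugate is a concave function of \<open>r\<^sup>2\<close>, so that one step of the scheme minimises over the
  dual feasible set a quadratic majorant touching the dual energy at the current iterate. Comparing
  with a point on the segment towards the dual minimiser and using strong convexity of the dual
  energy gives linear convergence with \<open>\<kappa> = m / (2 k\<^sub>2 L)\<close>.

  Finally \<open>(V y - V x)\<^sup>2\<close> is bounded by \<open>16 k\<^sub>2\<^sup>3\<close> times the Bregman distance of \<open>\<phi>\<^sub>\<delta>\<close>, which turns
  energy differences into the asserted distance; splitting at the regularized minimiser doubles
  the constant.\<close>

section \<open>One-variable calculus\<close>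

text \<open>The constant \<open>c\<close> may depend on \<open>k2\<close> but not on the relaxation
  interval, so the comparison of V with the Bregman distance cannot use the bounds \<open>m\<close>
  and \<open>L\<close> of the weight. It rests on a scale-invariant form of the upper half of
  uniform convexity, \<open>(\<mu> t - \<mu> s) * s \<le> (k2 - 1) * \<mu> t * (t - s)\<close>,
  which clamping \<mu> preserves. The bounds, which may degenerate with the interval, are left to
  the rate, to \<open>C\<^sub>\<delta>\<close> and to the energy gap.

  Neither regularized minimiser is given. The gap estimate compares \<open>u\<close> with every
  competitor, hence also bounds the regularized energy below; strong convexity then makes a
  minimizing sequence Cauchy. The dual minimiser is the flux of the primal one, so it needs no
  existence argument of its own.

  The analysis takes place in the image of \<open>V\<^sub>0\<close> under \<open>B\<close>, where
  the integrand terms decouple into functions of one variable. The trivial intersection of the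
  kernels permits this: it makes \<open>f \<bullet> v\<close> a function of \<open>B v\<close> on
  \<open>V\<^sub>0\<close>.\<close>

lemma minimum_by_derivative_sign:
  fixes f f' :: "real \<Rightarrow> real"
  assumes der: "\<And>t. t \<ge> 0 \<Longrightarrow> (f has_real_derivative f' t) (at t within {0..})"
    and up: "\<And>t. t \<ge> s \<Longrightarrow> f' t \<ge> 0"
    and down: "\<And>t. 0 \<le> t \<Longrightarrow> t \<le> s \<Longrightarrow> f' t \<le> 0"
    and "s \<ge> 0" "t \<ge> 0"
  shows "f s \<le> f t"
proof -
  have mvt: "\<exists>z. x \<le> z \<and> z \<le> y \<and> f y - f x = f' z * (y - x)" if "0 \<le> x" "x < y" for x y
  proof -
    have "(f has_derivative (\<lambda>h. f' z * h)) (at z within {x..y})" if "x \<le> z" "z \<le> y" for z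
      using der[of z] that \<open>0 \<le> x\<close>
      by (auto simp: has_field_derivative_def intro: has_derivative_subset)
    from mvt_simple[OF \<open>x < y\<close> this] obtain z where "x < z" "z < y" "f y - f x = f' z * (y - x)"
      by auto
    then show ?thesis by (intro exI[of _ z]) simp
  qed
  consider "s = t" | "s < t" | "t < s" by linarith
  then show ?thesis
  proof cases
    case 2
    then obtain z where "s \<le> z" "f t - f s = f' z * (t - s)"
      using mvt[of s t] assms by blast
    then show ?thesis using up[of z] 2
      by (metis diff_ge_0_iff_ge less_imp_le mult_nonneg_nonneg)
  next
    case 3
    then obtain z where z: "t \<le> z" "z \<le> s" "f s - f t = f' z * (s - t)"
      using mvt[of t s] assms by blast
    then have "f' z * (s - t) \<le> 0" using down[of z] 3 assms by (intro mult_nonpos_nonneg) auto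
    then show ?thesis using z by linarith
  qed auto
qed

text \<open>The condition \<open>p 0 = 0\<close> makes the two one-sided derivatives agree at the
  kink of \<open>abs\<close>. First-order conditions along lines need the two-sided derivative,
  since entries of \<open>B v\<close> change sign.\<close>

lemma has_real_derivative_even_extension:
  fixes P p :: "real \<Rightarrow> real"
  assumes der: "\<And>t. t \<ge> 0 \<Longrightarrow> (P has_real_derivative p t) (at t within {0..})" and "p 0 = 0"
  shows "((\<lambda>x. P (abs x)) has_real_derivative sgn x * p (abs x)) (at x)"
proof -
  have right: "((\<lambda>x. P (abs x)) has_real_derivative p x) (at x within {0..})" if "x \<ge> 0" for x
    by (rule has_field_derivative_transform_within[where d=1, OF der[OF that]]) (use that in simp_all)
  have left: "((\<lambda>x. P (abs x)) has_real_derivative - p (-x)) (at x within {..0})" if "x \<le> 0" for x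
  proof -
    have "(P has_real_derivative p (- x)) (at (- x) within uminus ` {..0})"
      using der[of "-x"] that by (simp add: image_uminus_atMost)
    moreover have "(uminus has_real_derivative -1) (at x within {..0})"
      by (auto intro!: derivative_eq_intros)
    ultimately have "(P \<circ> uminus has_real_derivative p (- x) * (-1)) (at x within {..0})"
      by (rule DERIV_image_chain)
    then have "((\<lambda>x. P (- x)) has_real_derivative p (- x) * (-1)) (at x within {..0})"
      by (simp add: o_def)
    then have "((\<lambda>x. P (- x)) has_real_derivative - p (-x)) (at x within {..0})" by simp
    then show ?thesis by (rule has_field_derivative_transform_within[where d=1]) (use that in simp_all)
  qed
  consider "x > 0" | "x < 0" | "x = 0" by linarith
  then show ?thesis
  proof cases
    case 1
    then have "at x within {0..} = at x" by (intro at_within_interior) simp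
    with 1 right[of x] show ?thesis by simp
  next
    case 2
    then have "at x within {..0} = at x" by (intro at_within_interior) simp
    with 2 left[of x] show ?thesis by simp
  next
    case 3
    have "UNIV = {..0} \<union> {0::real..}" by auto
    then have at_eq: "at x = sup (at x within {..0}) (at x within {0..})"
      using at_within_union[of x "{..0}" "{0..}"] by simp
    have "((\<lambda>x. P (abs x)) has_real_derivative sgn x * p (abs x)) (at x within {..0})"
      "((\<lambda>x. P (abs x)) has_real_derivative sgn x * p (abs x)) (at x within {0..})"
      using right[of x] left[of x] 3 \<open>p 0 = 0\<close> by simp_all
    then show ?thesis
      unfolding has_field_derivative_iff by (subst at_eq) (rule filterlim_sup)
  qed
qed

text \<open>A change of sign costs the nonnegative extra \<open>abs y - sgn x * y\<close>, which
  vanishes when \<open>x\<close> and \<open>y\<close> have the same sign. The squared distance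
  splits off the same extra in \<open>square_diff_eq_square_abs_diff\<close>, so quadratic bounds on
  the half line carry over term by term.\<close>

lemma bregman_even_extension:
  fixes P p :: "real \<Rightarrow> real"
  assumes "p 0 = 0"
  shows "P (abs y) - P (abs x) - sgn x * p (abs x) * (y - x)
    = (P (abs y) - P (abs x) - p (abs x) * (abs y - abs x)) + p (abs x) * (abs y - sgn x * y)"
  using assms by (cases "x = 0"; auto simp: sgn_if abs_if algebra_simps)

lemma square_diff_eq_square_abs_diff:
  fixes x y :: real
  shows "(y - x)\<^sup>2 = (abs y - abs x)\<^sup>2 + 2 * abs x * (abs y - sgn x * y)"
  by (cases "x = 0"; auto simp: sgn_if abs_if power2_eq_square algebra_simps)

lemma bregman_even_extension_lower:
  fixes P p :: "real \<Rightarrow> real"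
  assumes "p 0 = 0"
    and "\<And>s t. 0 \<le> s \<Longrightarrow> 0 \<le> t \<Longrightarrow> m / 2 * (t - s)\<^sup>2 \<le> P t - P s - p s * (t - s)"
    and "\<And>s. 0 \<le> s \<Longrightarrow> m * s \<le> p s"
  shows "m / 2 * (y - x)\<^sup>2 \<le> P (abs y) - P (abs x) - sgn x * p (abs x) * (y - x)"
proof -
  have "m * (abs x) * (abs y - sgn x * y) \<le> p (abs x) * (abs y - sgn x * y)"
    using assms(3)[of "abs x"] by (intro mult_right_mono) (auto simp: sgn_if)
  then show ?thesis
    using assms(2)[of "abs x" "abs y"]
    unfolding bregman_even_extension[of p, OF assms(1)] square_diff_eq_square_abs_diff[of y x]
    by (simp add: algebra_simps)
qed

text \<open>Negating \<open>P\<close>, \<open>p\<close> and \<open>m\<close> reduces this to the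
  lower bound, which assumes no sign of \<open>m\<close>.\<close>

lemma bregman_even_extension_upper:
  fixes P p :: "real \<Rightarrow> real"
  assumes "p 0 = 0"
    and "\<And>s t. 0 \<le> s \<Longrightarrow> 0 \<le> t \<Longrightarrow> P t - P s - p s * (t - s) \<le> m / 2 * (t - s)\<^sup>2"
    and "\<And>s. 0 \<le> s \<Longrightarrow> p s \<le> m * s"
  shows "P (abs y) - P (abs x) - sgn x * p (abs x) * (y - x) \<le> m / 2 * (y - x)\<^sup>2"
proof -
  have "- m / 2 * (t - s)\<^sup>2 \<le> - P t - - P s - - p s * (t - s)" if "0 \<le> s" "0 \<le> t" for s t
    using assms(2)[OF that] by simp
  then show ?thesis
    using bregman_even_extension_lower[of "\<lambda>t. - p t" "- m" "\<lambda>t. - P t" y x] assms(1,3) by simp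
qed

section \<open>Integrands with bounded nondecreasing weight\<close>

text \<open>Here \<mu> is the derivative of \<psi> divided by its argument. Adding
  \<open>\<mu> t * (t - s)\<close> to both sides of the growth condition gives the upper uniform
  convexity bound with constant \<open>K\<close>; the form chosen here survives clamping. Right
  continuity at 0 serves the limit convention of the scheme at zero entries.\<close>

locale relaxed_integrand =
  fixes \<psi> \<mu> :: "real \<Rightarrow> real" and L K :: real
  assumes weight_0_pos: "0 < \<mu> 0"
    and weight_mono: "mono_on {0..} \<mu>"
    and weight_le: "0 \<le> t \<Longrightarrow> \<mu> t \<le> L"
    and weight_cont_0: "(\<mu> \<longlongrightarrow> \<mu> 0) (at_right 0)"
    and K_ge_1: "1 \<le> K"
    and weight_growth: "0 \<le> s \<Longrightarrow> s \<le> t \<Longrightarrow> (\<mu> t - \<mu> s) * s \<le> (K - 1) * \<mu> t * (t - s)"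
    and deriv_integrand: "0 \<le> t \<Longrightarrow> (\<psi> has_real_derivative \<mu> t * t) (at t within {0..})"
begin

abbreviation "m \<equiv> \<mu> 0"
abbreviation "\<Lambda> \<equiv> K * L"

lemma weight_ge: "0 \<le> t \<Longrightarrow> m \<le> \<mu> t"
  using weight_mono by (auto simp: mono_on_def)

lemma weight_pos: "0 \<le> t \<Longrightarrow> 0 < \<mu> t"
  using weight_ge weight_0_pos by fastforce

lemma m_le_\<Lambda>: "m \<le> \<Lambda>"
proof -
  have "m \<le> 1 * L" using weight_le[of 0] by simp
  also have "\<dots> \<le> \<Lambda>" using K_ge_1 weight_le[of 0] weight_0_pos by (intro mult_right_mono) auto
  finally show ?thesis .
qed

lemma \<Lambda>_pos: "0 < \<Lambda>"
  using m_le_\<Lambda> weight_0_pos by linarith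

lemma deriv_diff_lower:
  assumes "0 \<le> s" "s \<le> t" shows "\<mu> t * (t - s) \<le> \<mu> t * t - \<mu> s * s"
proof -
  have "0 \<le> (\<mu> t - \<mu> s) * s" using assms weight_mono by (auto simp: mono_on_def)
  then show ?thesis by (simp add: algebra_simps)
qed

lemma deriv_diff_upper:
  assumes "0 \<le> s" "s \<le> t" shows "\<mu> t * t - \<mu> s * s \<le> K * \<mu> t * (t - s)"
  using weight_growth[OF assms] by (simp add: algebra_simps)

lemma deriv_diff_lower_m:
  assumes "0 \<le> s" "s \<le> t" shows "m * (t - s) \<le> \<mu> t * t - \<mu> s * s"
  using deriv_diff_lower[OF assms] weight_ge[of t] assms
  by (meson diff_ge_0_iff_ge dual_order.trans mult_right_mono)

lemma deriv_diff_upper_\<Lambda>: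
  assumes "0 \<le> s" "s \<le> t" shows "\<mu> t * t - \<mu> s * s \<le> \<Lambda> * (t - s)"
proof -
  have "K * \<mu> t * (t - s) \<le> \<Lambda> * (t - s)"
    using weight_le[of t] assms K_ge_1 by (intro mult_right_mono) auto
  then show ?thesis using deriv_diff_upper[OF assms] by linarith
qed

text \<open>Subtracting the quadratic leaves a function of \<open>t\<close> whose derivative is
  nonpositive before \<open>s\<close> and nonnegative after it, so \<open>s\<close> minimises
  it.\<close>

lemma bregman_lower:
  assumes "0 \<le> s" "0 \<le> t"
  shows "m / 2 * (t - s)\<^sup>2 \<le> \<psi> t - \<psi> s - \<mu> s * s * (t - s)"
proof -
  let ?f = "\<lambda>t. \<psi> t - \<mu> s * s * (t - s) - m / 2 * (t - s)\<^sup>2"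
  have "?f s \<le> ?f t"
  proof (rule minimum_by_derivative_sign[where f="?f" and s=s and t=t and f'="\<lambda>t. \<mu> t * t - \<mu> s * s - m * (t - s)"])
    show "(?f has_real_derivative \<mu> t * t - \<mu> s * s - m * (t - s)) (at t within {0..})"
      if "t \<ge> 0" for t
      using deriv_integrand[OF that] by (auto intro!: derivative_eq_intros)
  qed (use assms deriv_diff_lower_m[of s] deriv_diff_lower_m[of _ s] in
        \<open>auto simp: algebra_simps\<close>)
  then show ?thesis by (simp add: algebra_simps)
qed

lemma bregman_upper:
  assumes "0 \<le> s" "0 \<le> t"
  shows "\<psi> t - \<psi> s - \<mu> s * s * (t - s) \<le> \<Lambda> / 2 * (t - s)\<^sup>2"
proof -
  let ?f = "\<lambda>t. \<Lambda> / 2 * (t - s)\<^sup>2 - \<psi> t + \<mu> s * s * (t - s)"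
  have "?f s \<le> ?f t"
  proof (rule minimum_by_derivative_sign[where f="?f" and s=s and t=t and f'="\<lambda>t. \<Lambda> * (t - s) - (\<mu> t * t - \<mu> s * s)"])
    show "(?f has_real_derivative \<Lambda> * (t - s) - (\<mu> t * t - \<mu> s * s)) (at t within {0..})"
      if "t \<ge> 0" for t
      using deriv_integrand[OF that] by (auto intro!: derivative_eq_intros)
  qed (use assms deriv_diff_upper_\<Lambda>[of s] deriv_diff_upper_\<Lambda>[of _ s] in
        \<open>auto simp: algebra_simps\<close>)
  then show ?thesis by (simp add: algebra_simps)
qed

lemma subgradient:
  assumes "0 \<le> s" "0 \<le> t"
  shows "\<psi> s + \<mu> s * s * (t - s) \<le> \<psi> t"
proof -
  have "0 \<le> m / 2 * (t - s)\<^sup>2" using weight_0_pos by simp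
  then show ?thesis using bregman_lower[OF assms] by linarith
qed

text \<open>The slope of \<psi> with respect to the square of its argument is
  \<open>\<mu> t / 2\<close>, which is nondecreasing. So \<psi> is convex in the square, and this
  tangent inequality yields the quadratic majorant of the conjugate.\<close>

lemma integrand_ge_quadratic:
  assumes "0 \<le> s" "0 \<le> t"
  shows "\<mu> s / 2 * (t\<^sup>2 - s\<^sup>2) \<le> \<psi> t - \<psi> s"
proof -
  let ?f = "\<lambda>t. \<psi> t - \<mu> s / 2 * t\<^sup>2"
  have "?f s \<le> ?f t"
  proof (rule minimum_by_derivative_sign[where f="?f" and s=s and t=t and f'="\<lambda>t. (\<mu> t - \<mu> s) * t"])
    show "(?f has_real_derivative (\<mu> t - \<mu> s) * t) (at t within {0..})"
      if "t \<ge> 0" for t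
      using deriv_integrand[OF that] by (auto intro!: derivative_eq_intros simp: algebra_simps)
  qed (use assms weight_mono in \<open>auto simp: mono_on_def intro!: mult_nonneg_nonneg mult_nonpos_nonneg\<close>)
  then show ?thesis by (simp add: algebra_simps)
qed

lemma even_deriv_eq: "sgn x * (\<mu> (abs x) * (abs x)) = \<mu> (abs x) * x"
  by (simp add: sgn_if abs_if)

lemma bregman_even_lower:
  "m / 2 * (y - x)\<^sup>2 \<le> \<psi> (abs y) - \<psi> (abs x) - \<mu> (abs x) * x * (y - x)"
  using bregman_even_extension_lower[of "\<lambda>t. \<mu> t * t" m \<psi> y x, OF _ bregman_lower]
    weight_ge unfolding even_deriv_eq by (simp add: mult_right_mono)

lemma bregman_even_upper:
  "\<psi> (abs y) - \<psi> (abs x) - \<mu> (abs x) * x * (y - x) \<le> \<Lambda> / 2 * (y - x)\<^sup>2"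
  using bregman_even_extension_upper[of "\<lambda>t. \<mu> t * t" \<psi> \<Lambda> y x, OF _ bregman_upper]
    deriv_diff_upper_\<Lambda>[of 0] unfolding even_deriv_eq by simp

text \<open>The weight at the base point \<open>t\<close> may be far smaller than
  \<open>\<mu> s\<close>. One steps back from \<open>s\<close> by \<open>h\<close>, so short that
  the growth condition keeps half of the weight at \<open>r\<close>, and chains the subgradient
  inequalities through \<open>r\<close>. The factors 2, 2 and \<open>2 * K\<close> come from the
  weight, from \<open>r - t\<close> and from \<open>h\<close>.\<close>

lemma bregman_ge_right:
  assumes "0 \<le> t" "t \<le> s"
  shows "\<mu> s * (s - t)\<^sup>2 / (8 * K) \<le> \<psi> s - \<psi> t - \<mu> t * t * (s - t)"
proof (cases "s = t")
  case False
  then have "t < s" "0 < s" using assms by auto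
  define h where "h = (s - t) / (2 * K)"
  define r where "r = s - h"
  have K: "K > 0" using K_ge_1 by simp
  have h: "0 < h" "h \<le> (s - t) / 2" "2 * K * h = s - t"
    using \<open>t < s\<close> K_ge_1 mult_left_mono[of 1 K "s - t"] unfolding h_def by (auto simp: field_simps)
  have r: "(s - t) / 2 \<le> r - t" "r \<le> s" "0 \<le> r" using h assms unfolding r_def by (auto simp: field_simps)
  have "\<mu> s * r - \<mu> r * r \<le> (K - 1) * \<mu> s * h"
    using weight_growth[of r s] r by (simp add: r_def algebra_simps)
  then have "\<mu> s * (s - K * h) \<le> \<mu> r * r"
    by (simp add: r_def algebra_simps)
  also have "\<dots> \<le> \<mu> r * s" using r weight_pos[of r] by (intro mult_left_mono) auto
  finally have *: "\<mu> s * (s - K * h) \<le> \<mu> r * s" .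
  have "s / 2 \<le> s - K * h" using h assms by linarith
  then have "\<mu> s * (s / 2) \<le> \<mu> s * (s - K * h)"
    using weight_pos[of s] \<open>0 < s\<close> by (intro mult_left_mono) auto
  with * have "(\<mu> s / 2) * s \<le> \<mu> r * s" by simp
  then have half: "\<mu> s / 2 \<le> \<mu> r" using \<open>0 < s\<close> by simp
  have "\<mu> s * (s - t)\<^sup>2 / (8 * K) = \<mu> s / 2 * ((s - t) / 2) * h"
    unfolding h_def by (simp add: power2_eq_square)
  also have "\<dots> \<le> \<mu> r * (r - t) * h"
    using half r h weight_pos[of s] \<open>0 < s\<close> \<open>t < s\<close> by (intro mult_right_mono mult_mono) auto
  also have "\<dots> \<le> (\<mu> r * r - \<mu> t * t) * h"
    using deriv_diff_lower[of t r] assms r h \<open>t < s\<close> by (intro mult_right_mono) auto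
  also have "\<dots> = \<mu> r * r * (s - r) + \<mu> t * t * (r - t) - \<mu> t * t * (s - t)"
    unfolding r_def by (simp add: algebra_simps)
  also have "\<dots> \<le> \<psi> s - \<psi> t - \<mu> t * t * (s - t)"
    using subgradient[of r s] subgradient[of t r] r assms h \<open>t < s\<close> by (simp add: algebra_simps)
  finally show ?thesis .
qed simp

text \<open>Now the base point carries the larger weight, so the midpoint suffices and no factor
  \<open>K\<close> is lost.\<close>

lemma bregman_ge_left:
  assumes "0 \<le> t" "t \<le> s"
  shows "\<mu> s * (s - t)\<^sup>2 / 4 \<le> \<psi> t - \<psi> s - \<mu> s * s * (t - s)"
proof -
  define q where "q = (s + t) / 2"
  have q: "s - q = (s - t) / 2" "q - t = (s - t) / 2" "0 \<le> q" "q \<le> s" "t \<le> q"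
    using assms unfolding q_def by (auto simp: field_simps)
  have "\<mu> s * (s - t)\<^sup>2 / 4 = \<mu> s * (s - q) * (q - t)"
    unfolding q by (simp add: power2_eq_square)
  also have "\<dots> \<le> (\<mu> s * s - \<mu> q * q) * (q - t)"
    by (rule mult_right_mono[OF deriv_diff_lower]) (use q in simp_all)
  also have "\<dots> = \<mu> q * q * (t - q) + \<mu> s * s * (q - s) - \<mu> s * s * (t - s)"
    by (simp add: algebra_simps)
  also have "\<dots> \<le> \<psi> t - \<psi> s - \<mu> s * s * (t - s)"
    using subgradient[of q t] subgradient[of s q] q assms by linarith
  finally show ?thesis .
qed

section \<open>Comparison of V with the Bregman distance\<close>

definition V :: "real \<Rightarrow> real" where "V x = sqrt (\<mu> (abs x)) * x"

text \<open>Split \<open>V s - V t\<close> into \<open>sqrt (\<mu> s) * (s - t)\<close> and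
  \<open>(sqrt (\<mu> s) - sqrt (\<mu> t)) * t\<close>. Factoring \<open>\<mu> s - \<mu> t\<close>
  as a difference of squares, the growth condition bounds the second part by \<open>K - 1\<close>
  times the first.\<close>

lemma V_diff_same_sign:
  assumes "0 \<le> t" "t \<le> s" shows "(V s - V t)\<^sup>2 \<le> K\<^sup>2 * (\<mu> s * (s - t)\<^sup>2)"
proof -
  define x where "x = sqrt (\<mu> s)"
  define y where "y = sqrt (\<mu> t)"
  have xy: "0 < y" "y \<le> x" "x\<^sup>2 = \<mu> s" "y\<^sup>2 = \<mu> t"
    using assms weight_pos[of s] weight_pos[of t] weight_mono
    by (auto simp: x_def y_def mono_on_def)
  have "x * ((x - y) * t) \<le> (x + y) * ((x - y) * t)"
    using xy assms by (intro mult_right_mono) auto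
  also have "\<dots> = (x\<^sup>2 - y\<^sup>2) * t" by (simp add: power2_eq_square algebra_simps)
  also have "\<dots> \<le> (K - 1) * x\<^sup>2 * (s - t)" using weight_growth[OF assms] xy by simp
  finally have "x * ((x - y) * t) \<le> x * ((K - 1) * x * (s - t))"
    by (simp add: power2_eq_square algebra_simps)
  then have "(x - y) * t \<le> (K - 1) * x * (s - t)" using xy by simp
  then have "V s - V t \<le> K * x * (s - t)"
    using assms by (simp add: V_def x_def y_def algebra_simps)
  moreover have "0 \<le> V s - V t"
    using assms xy by (auto simp: V_def x_def y_def intro!: mult_mono)
  ultimately have "(V s - V t)\<^sup>2 \<le> (K * x * (s - t))\<^sup>2" by (intro power_mono)
  then show ?thesis using xy by (simp add: power_mult_distrib)
qed

lemma V_minus: "V (- x) = - V x"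
  by (simp add: V_def)

lemma V_square: "0 \<le> x \<Longrightarrow> (V x)\<^sup>2 = \<mu> x * x\<^sup>2"
  using weight_pos[of x] by (simp add: V_def power_mult_distrib)

text \<open>Points of equal sign are compared through the larger weight, points of opposite sign
  through 0. The constant dominates those of all cases: \<open>4 * K\<^sup>2\<close> when
  \<open>y\<close> lies between 0 and \<open>x\<close>, \<open>8 * K ^ 3\<close> when
  \<open>y\<close> lies beyond \<open>x\<close>, and \<open>16 * K\<close> and \<open>8\<close>
  across 0.\<close>

lemma V_diff_le_bregman:
  "(V y - V x)\<^sup>2 \<le> 16 * K ^ 3 * (\<psi> (abs y) - \<psi> (abs x) - \<mu> (abs x) * x * (y - x))"
proof -
  have K: "K > 0" using K_ge_1 by simp
  have K2: "K\<^sup>2 * 4 \<le> 16 * K ^ 3" "K\<^sup>2 * (8 * K) \<le> 16 * K ^ 3" "8 \<le> 16 * K ^ 3" "16 * K \<le> 16 * K ^ 3"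
    using K_ge_1 power_increasing[of 2 3 K] power_increasing[of 1 3 K] power_increasing[of 0 3 K]
    by (simp_all add: power2_eq_square power3_eq_cube)
  \<comment> \<open>by oddness of \<open>V\<close> one may assume \<open>x \<ge> 0\<close>\<close>
  have pos: "(V y - V x)\<^sup>2 \<le> 16 * K ^ 3 * (\<psi> (abs y) - \<psi> (abs x) - \<mu> (abs x) * x * (y - x))"
    if "0 \<le> x" for x y
  proof -
    consider "0 \<le> y" "y \<le> x" | "x \<le> y" | "y < 0" by linarith
    then show ?thesis
    proof cases
      case 1
      define R where "R = \<psi> y - \<psi> x - \<mu> x * x * (y - x)"
      have R: "\<mu> x * (x - y)\<^sup>2 \<le> 4 * R" using bregman_ge_left[of y x] 1 unfolding R_def by simp
      moreover have "0 \<le> \<mu> x * (x - y)\<^sup>2" using weight_pos[of x] that by simp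
      ultimately have R0: "0 \<le> R" by linarith
      have "(V x - V y)\<^sup>2 \<le> K\<^sup>2 * (\<mu> x * (x - y)\<^sup>2)" using V_diff_same_sign 1 by simp
      also have "\<dots> \<le> K\<^sup>2 * (4 * R)" by (rule mult_left_mono[OF R]) simp
      also have "\<dots> \<le> 16 * K ^ 3 * R" using mult_right_mono[OF K2(1) R0]
        by (simp add: mult.assoc)
      finally show ?thesis using 1 that by (simp add: power2_commute R_def)
    next
      case 2
      define R where "R = \<psi> y - \<psi> x - \<mu> x * x * (y - x)"
      have R: "\<mu> y * (y - x)\<^sup>2 \<le> 8 * K * R"
        using bregman_ge_right[of x y] 2 that K unfolding R_def by (simp add: field_simps)
      moreover have "0 \<le> \<mu> y * (y - x)\<^sup>2" using weight_pos[of y] 2 that by simp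
      ultimately have "0 \<le> 8 * K * R" by linarith
      then have R0: "0 \<le> R" using K by (simp add: zero_le_mult_iff)
      have "(V y - V x)\<^sup>2 \<le> K\<^sup>2 * (\<mu> y * (y - x)\<^sup>2)" using V_diff_same_sign 2 that by simp
      also have "\<dots> \<le> K\<^sup>2 * (8 * K * R)" by (rule mult_left_mono[OF R]) simp
      also have "\<dots> \<le> 16 * K ^ 3 * R" using mult_right_mono[OF K2(2) R0] by (simp add: mult.assoc)
      finally show ?thesis using 2 that by (simp add: R_def)
    next
      case 3
      define z where "z = - y"
      have z: "0 \<le> z" using 3 by (simp add: z_def)
      \<comment> \<open>These are the Bregman distances from base 0 to \<open>z\<close> and from
        base \<open>x\<close> to 0. Their sum falls short of the whole distance by
        \<open>\<mu> x * x * z\<close>, which is nonnegative.\<close>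
      define R1 where "R1 = \<psi> z - \<psi> 0"
      define R2 where "R2 = \<psi> 0 - \<psi> x + \<mu> x * x * x"
      have R1: "\<mu> z * z\<^sup>2 \<le> 8 * K * R1"
        using bregman_ge_right[of 0 z] z K unfolding R1_def by (simp add: field_simps)
      have R2: "\<mu> x * x\<^sup>2 \<le> 4 * R2"
        using bregman_ge_left[of 0 x] that unfolding R2_def by (simp add: field_simps)
      have "0 \<le> \<mu> z * z\<^sup>2" "0 \<le> \<mu> x * x\<^sup>2"
        using weight_pos[of z] z weight_pos[of x] that by simp_all
      with R1 R2 have "0 \<le> 8 * K * R1" and R20: "0 \<le> R2" by linarith+
      then have R10: "0 \<le> R1" using K by (simp add: zero_le_mult_iff)
      have "(V y - V x)\<^sup>2 = (V z + V x)\<^sup>2"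
        using V_minus[of z] by (simp add: z_def power2_eq_square algebra_simps)
      also have "\<dots> \<le> 2 * (V z)\<^sup>2 + 2 * (V x)\<^sup>2"
        using sum_squares_bound[of "V z" "V x"] by (simp add: power2_sum)
      also have "\<dots> \<le> 16 * K * R1 + 8 * R2"
        using R1 R2 V_square[OF z] V_square[OF that] by simp
      also have "\<dots> \<le> 16 * K ^ 3 * R1 + 16 * K ^ 3 * R2"
        using K2 R10 R20 by (intro add_mono mult_right_mono)
      also have "\<dots> = 16 * K ^ 3 * (\<psi> z - \<psi> x + \<mu> x * x * x)"
        by (simp add: R1_def R2_def algebra_simps)
      also have "\<dots> \<le> 16 * K ^ 3 * (\<psi> z - \<psi> x + \<mu> x * x * x + \<mu> x * x * z)"
        using K z that weight_pos[of x] by (intro mult_left_mono) auto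
      finally show ?thesis using 3 that by (simp add: z_def algebra_simps)
    qed
  qed
  show ?thesis
  proof (cases "0 \<le> x")
    case False
    then have "(V (- y) - V (- x))\<^sup>2
        \<le> 16 * K ^ 3 * (\<psi> (abs (- y)) - \<psi> (abs (- x)) - \<mu> (abs (- x)) * - x * (- y - - x))"
      by (intro pos) simp
    moreover have "(V (- y) - V (- x))\<^sup>2 = (V y - V x)\<^sup>2"
      by (simp add: V_minus power2_commute)
    ultimately show ?thesis by (simp add: algebra_simps)
  qed (use pos in auto)
qed

section \<open>The conjugate and its derivative\<close>

lemma continuous_deriv_integrand: "continuous_on {0..} (\<lambda>s. \<mu> s * s)"
proof (rule lipschitz_on_continuous_on)
  have le: "abs (\<mu> t * t - \<mu> s * s) \<le> \<Lambda> * abs (t - s)" if "0 \<le> s" "s \<le> t" for s t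
  proof -
    have "0 \<le> m * (t - s)" using that weight_0_pos by simp
    then show ?thesis
      using deriv_diff_upper_\<Lambda>[OF that] deriv_diff_lower_m[OF that] that by simp
  qed
  have "abs (\<mu> s * s - \<mu> t * t) \<le> \<Lambda> * abs (s - t)" if "0 \<le> s" "0 \<le> t" for s t
    using le[of s t] le[of t s] that by (cases "s \<le> t") (auto simp: abs_minus_commute)
  then show "\<Lambda>-lipschitz_on {0..} (\<lambda>s. \<mu> s * s)"
    using \<Lambda>_pos by (intro lipschitz_onI) (auto simp: dist_real_def)
qed

text \<open>The derivative grows at least like \<open>m * s\<close>, so it has reached
  \<open>r\<close> at \<open>r / m\<close>, and the intermediate value theorem applies.\<close>

lemma deriv_integrand_surj:
  assumes "0 \<le> r" shows "\<exists>s\<ge>0. \<mu> s * s = r"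
proof -
  have "r \<le> \<mu> (r / m) * (r / m)"
    using mult_right_mono[OF weight_ge[of "r / m"], of "r / m"] assms weight_0_pos by simp
  moreover have "continuous_on {0..r / m} (\<lambda>s. \<mu> s * s)"
    using continuous_deriv_integrand by (rule continuous_on_subset) auto
  ultimately show ?thesis
    using IVT'[of "\<lambda>s. \<mu> s * s" 0 r "r / m"] assms weight_0_pos by auto
qed

text \<open>The inverse of the derivative of \<psi>, hence the derivative of the conjugate;
  \<open>deriv_inj\<close> makes the choice unique.\<close>

definition \<rho> :: "real \<Rightarrow> real" where "\<rho> r = (SOME s. 0 \<le> s \<and> \<mu> s * s = r)"

lemma
  assumes "0 \<le> r"
  shows \<rho>_nonneg: "0 \<le> \<rho> r" and deriv_\<rho>: "\<mu> (\<rho> r) * \<rho> r = r"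
  using someI_ex[of "\<lambda>s. 0 \<le> s \<and> \<mu> s * s = r"] deriv_integrand_surj[OF assms]
  unfolding \<rho>_def by auto

lemma deriv_inj:
  assumes "0 \<le> s" "0 \<le> t" "\<mu> s * s = \<mu> t * t" shows "s = t"
proof -
  have le: "b \<le> a" if "0 \<le> a" "a \<le> b" "\<mu> a * a = \<mu> b * b" for a b
  proof -
    have "m * (b - a) \<le> 0" using deriv_diff_lower_m[OF that(1,2)] that(3) by linarith
    then show ?thesis using weight_0_pos by (simp add: mult_le_0_iff)
  qed
  show ?thesis
  proof (cases "s \<le> t")
    case True
    then show ?thesis using le[OF assms(1) True assms(3)] by linarith
  next
    case False
    then show ?thesis using le[OF assms(2) _ assms(3)[symmetric]] by linarith
  qed
qed

lemma \<rho>_deriv: "0 \<le> s \<Longrightarrow> \<rho> (\<mu> s * s) = s"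
  by (rule deriv_inj) (simp_all add: \<rho>_nonneg deriv_\<rho> weight_pos less_imp_le)

lemma \<rho>_0: "\<rho> 0 = 0"
  using \<rho>_deriv[of 0] by simp

lemma \<rho>_le: assumes "0 \<le> r" shows "\<rho> r \<le> r / m"
  using mult_right_mono[OF weight_ge[of "\<rho> r"] \<rho>_nonneg[of r]] \<rho>_nonneg[OF assms] deriv_\<rho>[OF assms] weight_0_pos assms
  by (simp add: field_simps)

lemma \<rho>_ge: assumes "0 \<le> r" shows "r / \<Lambda> \<le> \<rho> r"
  using deriv_diff_upper_\<Lambda>[of 0 "\<rho> r"] \<rho>_nonneg[OF assms] deriv_\<rho>[OF assms] \<Lambda>_pos
  by (simp add: divide_le_eq mult.commute)

lemma fenchel_young_\<rho>:
  assumes "0 \<le> r" "0 \<le> s" shows "r * s - \<psi> s \<le> r * \<rho> r - \<psi> (\<rho> r)"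
  using subgradient[OF \<rho>_nonneg[OF assms(1)] assms(2)] deriv_\<rho>[OF assms(1)]
  by (simp add: algebra_simps)

lemma fenchel_conj_eq: "0 \<le> r \<Longrightarrow> fenchel_conj \<psi> r = r * \<rho> r - \<psi> (\<rho> r)"
  unfolding fenchel_conj_def
  by (rule cSup_eq_maximum) (auto simp: \<rho>_nonneg fenchel_young_\<rho>)

lemma fenchel_young:
  assumes "0 \<le> r" "0 \<le> s" shows "r * s - \<psi> s \<le> fenchel_conj \<psi> r"
  using fenchel_young_\<rho>[OF assms] fenchel_conj_eq assms by simp

text \<open>Smoothness of \<psi> dualises to strong convexity: test the Fenchel-Young inequality at
  \<open>\<rho> r + h\<close>, where \<open>h\<close> maximises
  \<open>(q - r) * h - \<Lambda> / 2 * h\<^sup>2\<close>. The bound \<open>\<rho>_ge\<close> keeps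
  the test point nonnegative.\<close>

lemma conj_bregman_lower:
  assumes "0 \<le> r" "0 \<le> q"
  shows "(1 / \<Lambda>) / 2 * (q - r)\<^sup>2 \<le> fenchel_conj \<psi> q - fenchel_conj \<psi> r - \<rho> r * (q - r)"
proof -
  define h where "h = (q - r) / \<Lambda>"
  define s where "s = \<rho> r + h"
  have "q / \<Lambda> \<le> s" using \<rho>_ge[OF assms(1)] by (simp add: s_def h_def diff_divide_distrib)
  then have s: "0 \<le> s" using assms \<Lambda>_pos by (meson divide_nonneg_pos order_trans)
  have "\<psi> s - \<psi> (\<rho> r) - r * h \<le> \<Lambda> / 2 * h\<^sup>2"
    using bregman_upper[OF \<rho>_nonneg[OF assms(1)] s] deriv_\<rho>[OF assms(1)] by (simp add: s_def)
  moreover have "\<Lambda> * h = q - r" using \<Lambda>_pos unfolding h_def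
    by (metis less_irrefl nonzero_mult_div_cancel_left times_divide_eq_right)
  then have "\<Lambda> / 2 * h\<^sup>2 = (q - r) * h / 2" "(1 / \<Lambda>) / 2 * (q - r)\<^sup>2 = (q - r) * h / 2"
    by (auto simp: power2_eq_square h_def)
  ultimately show ?thesis
    using fenchel_young[OF assms(2) s] fenchel_conj_eq[OF assms(1)]
    by (simp add: s_def algebra_simps)
qed

text \<open>Strong convexity of \<psi> dualises to smoothness: insert the maximisers
  \<open>\<rho> q\<close> and \<open>\<rho> r\<close> and absorb the cross term by Young's
  inequality.\<close>

lemma conj_bregman_upper:
  assumes "0 \<le> r" "0 \<le> q"
  shows "fenchel_conj \<psi> q - fenchel_conj \<psi> r - \<rho> r * (q - r) \<le> (1 / m) / 2 * (q - r)\<^sup>2"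
proof -
  define x where "x = \<rho> q - \<rho> r"
  have "m / 2 * x\<^sup>2 \<le> \<psi> (\<rho> q) - \<psi> (\<rho> r) - r * x"
    using bregman_lower[OF \<rho>_nonneg[OF assms(1)] \<rho>_nonneg[OF assms(2)]] deriv_\<rho>[OF assms(1)]
    by (simp add: x_def)
  moreover have "(q - r) * x \<le> (1 / m) / 2 * (q - r)\<^sup>2 + m / 2 * x\<^sup>2"
    using sum_squares_bound[of "q - r" "m * x"] weight_0_pos
    by (simp add: field_simps power2_eq_square)
  ultimately show ?thesis
    using fenchel_conj_eq[OF assms(1)] fenchel_conj_eq[OF assms(2)]
    by (simp add: x_def algebra_simps)
qed

text \<open>The two quadratic Bregman bounds squeeze the difference quotient from both
  sides.\<close>

lemma has_derivative_fenchel_conj: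
  assumes "0 < r"
  shows "(fenchel_conj \<psi> has_real_derivative \<rho> r) (at r)"
  unfolding has_field_derivative_iff
proof (rule LIM_zero_cancel, rule Lim_null_comparison)
  let ?q = "\<lambda>q. (fenchel_conj \<psi> q - fenchel_conj \<psi> r) / (q - r) - \<rho> r"
  have "eventually (\<lambda>q. q > 0 \<and> q \<noteq> r) (at r)"
    using eventually_at_in_open[of "{0<..}" r] assms by (auto elim: eventually_mono)
  then show "eventually (\<lambda>q. norm (?q q) \<le> (1 / m) / 2 * abs (q - r)) (at r)"
  proof eventually_elim
    case (elim q)
    define R where "R = fenchel_conj \<psi> q - fenchel_conj \<psi> r - \<rho> r * (q - r)"
    have "0 \<le> (1 / \<Lambda>) / 2 * (q - r)\<^sup>2" using \<Lambda>_pos by simp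
    then have R: "abs R \<le> (1 / m) / 2 * (q - r)\<^sup>2"
      using conj_bregman_lower[of r q] conj_bregman_upper[of r q] elim assms unfolding R_def by auto
    have "?q q = R / (q - r)" using elim unfolding R_def by (simp add: field_simps)
    then have "norm (?q q) = abs R / abs (q - r)" by simp
    also have "\<dots> \<le> (1 / m) / 2 * (q - r)\<^sup>2 / abs (q - r)" by (rule divide_right_mono[OF R]) simp
    also have "(q - r)\<^sup>2 = abs (q - r) * abs (q - r)" by (simp add: power2_eq_square)
    also have "(1 / m) / 2 * (abs (q - r) * abs (q - r)) / abs (q - r) = (1 / m) / 2 * abs (q - r)"
      using elim by (metis diff_eq_diff_eq diff_self abs_eq_0 eq_iff_diff_eq_0 mult.assoc nonzero_mult_div_cancel_right)
    finally show ?case .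
  qed
  show "((\<lambda>q. (1 / m) / 2 * abs (q - r)) \<longlongrightarrow> 0) (at r)"
    by (rule tendsto_eq_intros refl weight_0_pos[THEN less_imp_neq, symmetric] | simp)+
qed

text \<open>This is \<open>abs x / \<rho> (abs x)\<close>, the weight of the scheme, with its limit
  \<open>m\<close> at 0 built in.\<close>

definition \<nu> :: "real \<Rightarrow> real" where "\<nu> x = \<mu> (\<rho> (abs x))"

lemma \<nu>_ge: "m \<le> \<nu> x"
  by (simp add: \<nu>_def \<rho>_nonneg weight_ge)

lemma \<nu>_pos: "0 < \<nu> x"
  using \<nu>_ge weight_0_pos by (rule order.strict_trans2[rotated])

lemma \<rho>_abs_eq: "\<rho> (abs x) = abs x / \<nu> x"
  using deriv_\<rho>[of "abs x"] \<nu>_pos[of x] by (simp add: \<nu>_def field_simps)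

lemma even_conj_deriv_eq: "sgn x * \<rho> (abs x) = x / \<nu> x"
  by (simp only: \<rho>_abs_eq) (simp add: sgn_if abs_if)

lemma conj_bregman_even_lower:
  "(1 / \<Lambda>) / 2 * (y - x)\<^sup>2
    \<le> fenchel_conj \<psi> (abs y) - fenchel_conj \<psi> (abs x) - x / \<nu> x * (y - x)"
  using bregman_even_extension_lower[of \<rho> "1 / \<Lambda>" "fenchel_conj \<psi>" y x, OF \<rho>_0 conj_bregman_lower]
    \<rho>_ge unfolding even_conj_deriv_eq by simp

text \<open>Since \<open>\<mu>\<close> is nondecreasing, the conjugate is a concave function of \<open>r\<^sup>2\<close>; its tangents
  are the quadratic majorants that one step of the scheme minimises.\<close>

lemma fenchel_conj_majorant:
  "fenchel_conj \<psi> (abs y) \<le> fenchel_conj \<psi> (abs x) + (y\<^sup>2 - x\<^sup>2) / (2 * \<nu> x)"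
proof -
  define k where "k = \<nu> x"
  define s where "s = \<rho> (abs y)"
  have k: "k > 0" using \<nu>_pos k_def by simp
  have x: "\<rho> (abs x) = abs x / k" by (simp add: \<rho>_abs_eq k_def)
  have "k / 2 * (s\<^sup>2 - (abs x / k)\<^sup>2) \<le> \<psi> s - \<psi> (abs x / k)"
    using integrand_ge_quadratic[of "\<rho> (abs x)" s]
    by (simp add: \<rho>_nonneg s_def flip: x) (simp add: k_def \<nu>_def)
  then have 1: "k / 2 * s\<^sup>2 - x\<^sup>2 / (2 * k) \<le> \<psi> s - \<psi> (abs x / k)"
    using k by (simp add: right_diff_distrib power_divide) (simp add: power2_eq_square)
  \<comment> \<open>Young's inequality with parameter \<open>k\<close>. Its term
    \<open>k / 2 * s\<^sup>2\<close> cancels against the one in the tangent bound for \<psi>, so the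
    maximiser \<open>s\<close> disappears.\<close>
  have 2: "abs y * s \<le> y\<^sup>2 / (2 * k) + k / 2 * s\<^sup>2"
    using sum_squares_bound[of "abs y" "k * s"] k
    by (simp add: divide_simps power_mult_distrib) (simp add: algebra_simps power2_eq_square)
  have "fenchel_conj \<psi> (abs y) = abs y * s - \<psi> s"
    by (simp add: fenchel_conj_eq s_def)
  moreover have "fenchel_conj \<psi> (abs x) = x\<^sup>2 / k - \<psi> (abs x / k)"
    by (simp add: fenchel_conj_eq x power2_eq_square)
  moreover have "x\<^sup>2 / k = 2 * (x\<^sup>2 / (2 * k))" "(y\<^sup>2 - x\<^sup>2) / (2 * k) = y\<^sup>2 / (2 * k) - x\<^sup>2 / (2 * k)"
    by (auto simp: diff_divide_distrib)
  ultimately show ?thesis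
    unfolding k_def[symmetric] using 1 2 by linarith
qed

lemma deriv_of_conj_deriv: "\<mu> (abs (x / \<nu> x)) * (x / \<nu> x) = x"
proof -
  have "abs (x / \<nu> x) = \<rho> (abs x)" using \<nu>_pos[of x] by (simp add: \<rho>_abs_eq)
  then show ?thesis using \<nu>_pos[of x] by (simp add: \<nu>_def[symmetric])
qed

lemma conj_deriv_of_deriv: "\<mu> (abs y) * y / \<nu> (\<mu> (abs y) * y) = y"
proof -
  have "abs (\<mu> (abs y) * y) = \<mu> (abs y) * abs y"
    using weight_pos[of "abs y"] by (simp add: abs_mult)
  then have "\<nu> (\<mu> (abs y) * y) = \<mu> (abs y)" by (simp add: \<nu>_def \<rho>_deriv)
  then show ?thesis using weight_pos[of "abs y"] by simp
qed

text \<open>Adding the strong convexity bounds at \<open>X\<close> and \<open>Y\<close> in both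
  orders shows that the derivative of the even extension is strongly monotone with modulus
  \<open>m\<close>; this map is its inverse.\<close>

lemma conj_deriv_lipschitz: "abs (x / \<nu> x - y / \<nu> y) \<le> abs (x - y) / m"
proof -
  define X where "X = x / \<nu> x"
  define Y where "Y = y / \<nu> y"
  have "\<mu> (abs X) * X = x" "\<mu> (abs Y) * Y = y"
    unfolding X_def Y_def by (rule deriv_of_conj_deriv)+
  then have "m * (X - Y)\<^sup>2 \<le> (x - y) * (X - Y)"
    using bregman_even_lower[of X Y] bregman_even_lower[of Y X]
    by (simp add: algebra_simps power2_commute[of Y X])
  also have "\<dots> \<le> abs (x - y) * abs (X - Y)" by (simp flip: abs_mult)
  finally have *: "m * abs (X - Y) * abs (X - Y) \<le> abs (x - y) * abs (X - Y)"
    by (simp add: power2_eq_square)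
  have "m * abs (X - Y) \<le> abs (x - y)"
  proof (cases "X = Y")
    case False
    then have "0 < abs (X - Y)" by simp
    with * show ?thesis by (rule mult_right_le_imp_le)
  qed simp
  then show ?thesis using weight_0_pos by (simp add: X_def Y_def field_simps)
qed

lemma weight_\<rho>_tendsto: "((\<lambda>r. \<mu> (\<rho> r)) \<longlongrightarrow> m) (at_right 0)"
proof (rule filterlim_compose[OF weight_cont_0])
  have "(\<rho> \<longlongrightarrow> 0) (at_right 0)"
  proof (rule tendsto_sandwich[of "\<lambda>_. 0" _ _ "\<lambda>r. r / m"])
    show "eventually (\<lambda>r. 0 \<le> \<rho> r) (at_right 0)" "eventually (\<lambda>r. \<rho> r \<le> r / m) (at_right 0)"
      using eventually_at_right_less[of 0]
      by (rule eventually_mono, simp add: \<rho>_nonneg \<rho>_le)+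
    show "((\<lambda>r. r / m) \<longlongrightarrow> 0) (at_right 0)"
      using tendsto_divide[OF tendsto_ident_at tendsto_const, of m 0 "{0<..}"] weight_0_pos by simp
  qed simp
  moreover have "eventually (\<lambda>r. \<rho> r \<in> {0<..} \<and> \<rho> r \<noteq> 0) (at_right 0)"
    using eventually_at_right_less[of 0]
  proof eventually_elim
    case (elim r)
    have "0 < r / \<Lambda>" using elim \<Lambda>_pos by simp
    then show ?case using \<rho>_ge[of r] elim by simp
  qed
  ultimately show "filterlim \<rho> (at_right 0) (at_right 0)"
    unfolding filterlim_at by auto
qed

text \<open>Away from 0 the quotient unfolds by the derivative of the conjugate. At 0 the limit
  gives the same formula, because \<rho> tends to 0 through positive values and \<mu> is right
  continuous there. The case distinction of the scheme thus disappears.\<close>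

lemma dirls_weight_eq:
  assumes "0 < \<omega>" shows "dirls_weight \<psi> \<omega> s = \<omega> * \<nu> (s / \<omega>)"
proof (cases "s = 0")
  case False
  have "deriv (fenchel_conj \<psi>) (inverse \<omega> * abs s) = \<rho> (abs (s / \<omega>))"
    using has_derivative_fenchel_conj[of "inverse \<omega> * abs s"] False assms
    by (simp add: DERIV_imp_deriv field_simps)
  also have "\<dots> = abs s / (\<omega> * \<nu> (s / \<omega>))"
    unfolding \<rho>_abs_eq using assms by simp
  finally show ?thesis
    using False \<nu>_pos[of "s / \<omega>"] assms by (simp add: dirls_weight_def)
next
  case True
  let ?f = "\<lambda>t. deriv (fenchel_conj \<psi>) (inverse \<omega> * t) / t"
  have "((\<lambda>t. 1 / (\<omega> * \<mu> (\<rho> (t / \<omega>)))) \<longlongrightarrow> 1 / (\<omega> * m)) (at_right 0)"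
  proof -
    have "filterlim (\<lambda>t. t / \<omega>) (at_right 0) (at_right (0::real))"
      using assms unfolding filterlim_at
      by (auto intro!: tendsto_eq_intros eventually_mono[OF eventually_at_right_less[of 0]])
    then have "((\<lambda>t. \<mu> (\<rho> (t / \<omega>))) \<longlongrightarrow> m) (at_right 0)"
      by (rule filterlim_compose[OF weight_\<rho>_tendsto])
    then show ?thesis using assms weight_0_pos by (auto intro!: tendsto_intros)
  qed
  moreover have "eventually (\<lambda>t. ?f t = 1 / (\<omega> * \<mu> (\<rho> (t / \<omega>)))) (at_right 0)"
    using eventually_at_right_less[of 0]
  proof eventually_elim
    case (elim t)
    then have "?f t = \<rho> (abs (t / \<omega>)) / t"
      using has_derivative_fenchel_conj[of "inverse \<omega> * t"] assms
      by (simp add: DERIV_imp_deriv field_simps)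
    also have "\<dots> = 1 / (\<omega> * \<mu> (\<rho> (t / \<omega>)))"
      using elim assms unfolding \<rho>_abs_eq by (simp add: \<nu>_def)
    finally show ?case .
  qed
  ultimately have "(?f \<longlongrightarrow> 1 / (\<omega> * m)) (at_right 0)"
    by (simp add: tendsto_cong)
  then have "Lim (at_right 0) ?f = 1 / (\<omega> * m)"
    by (intro tendsto_Lim) simp_all
  then show ?thesis using True by (simp add: dirls_weight_def \<nu>_def \<rho>_0)
qed

end

section \<open>Primal and dual energies over a subspace\<close>

text \<open>The integrand is arbitrary because the condition serves twice, for \<phi> at
  \<open>u\<close> and for \<psi> at the regularized minimiser. The line function has its minimum at
  \<open>t = 0\<close>.\<close>

lemma euler_lagrange:
  fixes P p :: "real \<Rightarrow> real" and y z w :: "nat \<Rightarrow> real"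
  assumes der: "\<And>t. t \<ge> 0 \<Longrightarrow> (P has_real_derivative p t) (at t within {0..})" and "p 0 = 0"
    and min: "\<And>t. (\<Sum>i\<in>I. w i * P (abs (y i))) \<le> (\<Sum>i\<in>I. w i * P (abs (y i + t * z i))) - t * c"
  shows "(\<Sum>i\<in>I. w i * (sgn (y i) * p (abs (y i))) * z i) = c"
proof -
  let ?F = "\<lambda>t. (\<Sum>i\<in>I. w i * P (abs (y i + t * z i))) - t * c"
  have "((\<lambda>t. P (abs (y i + t * z i))) has_real_derivative (sgn (y i) * p (abs (y i))) * z i) (at 0)" for i
  proof -
    have "((\<lambda>x. P (abs x)) has_real_derivative sgn (y i) * p (abs (y i))) (at (y i + 0 * z i))"
      using has_real_derivative_even_extension[OF der \<open>p 0 = 0\<close>] by simp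
    moreover have "((\<lambda>t. y i + t * z i) has_real_derivative z i) (at 0)"
      by (auto intro!: derivative_eq_intros)
    ultimately show ?thesis by (rule DERIV_chain2)
  qed
  then have "(?F has_real_derivative (\<Sum>i\<in>I. w i * ((sgn (y i) * p (abs (y i))) * z i)) - c) (at 0)"
    by (intro DERIV_diff DERIV_sum DERIV_cmult DERIV_cmult_Id[of c, unfolded mult.commute[of c]]) simp_all
  then have "(\<Sum>i\<in>I. w i * ((sgn (y i) * p (abs (y i))) * z i)) - c = 0"
    by (rule DERIV_local_min[where d=1]) (use min in auto)
  then show ?thesis by (simp add: mult.assoc)
qed

text \<open>The problem seen through \<open>B\<close>: \<open>y0\<close> stands for
  \<open>B g\<close>, \<open>S\<close> for the image of \<open>V\<^sub>0\<close>, and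
  \<open>h\<close> represents the load on it. Only coordinates below \<open>M\<close> count, so
  closedness asks for the convergence of these alone.\<close>

locale dirls_problem = relaxed_integrand +
  fixes M :: nat and w y0 h :: "nat \<Rightarrow> real" and S :: "(nat \<Rightarrow> real) set"
  assumes w_pos: "i < M \<Longrightarrow> 0 < w i"
    and S_0: "(\<lambda>_. 0) \<in> S"
    and S_lincomb: "x \<in> S \<Longrightarrow> y \<in> S \<Longrightarrow> (\<lambda>i. a * x i + b * y i) \<in> S"
    and S_closed: "(\<And>n. Y n \<in> S) \<Longrightarrow> (\<And>i. i < M \<Longrightarrow> (\<lambda>n. Y n i) \<longlonglongrightarrow> y i) \<Longrightarrow> y \<in> S"
begin

text \<open>For \<open>z\<close> the image of \<open>v\<close> this is the primal energy at
  \<open>v + g\<close> up to the constant \<open>f \<bullet> g\<close>.\<close>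

definition J :: "(nat \<Rightarrow> real) \<Rightarrow> real" where
  "J z = (\<Sum>i<M. w i * \<psi> (abs (y0 i + z i))) - (\<Sum>i<M. h i * z i)"

definition dJ :: "(nat \<Rightarrow> real) \<Rightarrow> (nat \<Rightarrow> real) \<Rightarrow> real" where
  "dJ z x = (\<Sum>i<M. w i * (\<mu> (abs (y0 i + z i)) * (y0 i + z i)) * x i) - (\<Sum>i<M. h i * x i)"

lemma S_diff: "x \<in> S \<Longrightarrow> y \<in> S \<Longrightarrow> (\<lambda>i. x i - y i) \<in> S"
  using S_lincomb[of x y 1 "-1"] by simp

lemma J_bregman:
  "J x - J z - dJ z (\<lambda>i. x i - z i)
    = (\<Sum>i<M. w i * (\<psi> (abs (y0 i + x i)) - \<psi> (abs (y0 i + z i))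
        - \<mu> (abs (y0 i + z i)) * (y0 i + z i) * ((y0 i + x i) - (y0 i + z i))))"
  unfolding J_def dJ_def by (simp add: algebra_simps sum.distrib sum_subtractf)

lemma J_strongly_convex:
  "J z + dJ z (\<lambda>i. x i - z i) + m / 2 * (\<Sum>i<M. w i * (x i - z i)\<^sup>2) \<le> J x"
proof -
  have "m / 2 * (\<Sum>i<M. w i * (x i - z i)\<^sup>2) = (\<Sum>i<M. w i * (m / 2 * ((y0 i + x i) - (y0 i + z i))\<^sup>2))"
    by (simp add: sum_distrib_left algebra_simps)
  also have "\<dots> \<le> J x - J z - dJ z (\<lambda>i. x i - z i)"
    unfolding J_bregman using w_pos
    by (intro sum_mono mult_left_mono bregman_even_lower) (auto intro: less_imp_le)
  finally show ?thesis by simp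
qed

lemma dJ_minus: "dJ z (\<lambda>i. - x i) = - dJ z x"
  by (simp add: dJ_def sum_negf)

text \<open>The directions from the midpoint to \<open>x\<close> and to \<open>y\<close> are
  opposite, so the linear terms cancel and only the strong convexity terms remain.\<close>

lemma J_midpoint:
  assumes "\<And>i. 2 * z i = x i + y i"
  shows "2 * J z + m / 4 * (\<Sum>i<M. w i * (x i - y i)\<^sup>2) \<le> J x + J y"
proof -
  have x: "(\<lambda>i. x i - z i) = (\<lambda>i. (x i - y i) / 2)" and y: "(\<lambda>i. y i - z i) = (\<lambda>i. - ((x i - y i) / 2))"
    using assms by (auto simp: fun_eq_iff field_simps)
  have sq: "(\<Sum>i<M. w i * ((x i - y i) / 2)\<^sup>2) = (\<Sum>i<M. w i * (x i - y i)\<^sup>2) / 4"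
    by (simp add: power_divide sum_divide_distrib)
  have "J z + dJ z (\<lambda>i. (x i - y i) / 2) + m / 2 * ((\<Sum>i<M. w i * (x i - y i)\<^sup>2) / 4) \<le> J x"
    using J_strongly_convex[of z x] unfolding fun_cong[OF x] sq .
  moreover have "J z - dJ z (\<lambda>i. (x i - y i) / 2) + m / 2 * ((\<Sum>i<M. w i * (x i - y i)\<^sup>2) / 4) \<le> J y"
    using J_strongly_convex[of z y] unfolding fun_cong[OF y] dJ_minus power2_minus sq by simp
  ultimately show ?thesis by simp
qed

lemma J_tendsto:
  assumes "\<And>i. i < M \<Longrightarrow> (\<lambda>n. Y n i) \<longlonglongrightarrow> y i"
  shows "(\<lambda>n. J (Y n)) \<longlonglongrightarrow> J y"
proof -
  have "isCont (\<lambda>x. \<psi> (abs x)) x" for x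
    using has_real_derivative_even_extension[of \<psi> "\<lambda>t. \<mu> t * t", OF deriv_integrand]
    by (auto intro: DERIV_isCont)
  then have "(\<lambda>n. \<psi> (abs (y0 i + Y n i))) \<longlonglongrightarrow> \<psi> (abs (y0 i + y i))" if "i < M" for i
    by (rule isCont_tendsto_compose) (intro tendsto_intros assms that)
  then show ?thesis
    unfolding J_def by (intro tendsto_intros assms) auto
qed

text \<open>No compactness is involved: the midpoint of two near-minimisers cannot fall below the
  infimum, so \<open>J_midpoint\<close> forces them together and a minimizing sequence is
  Cauchy.\<close>

lemma ex_minimizer:
  assumes bound: "\<And>z. z \<in> S \<Longrightarrow> c \<le> J z"
  shows "\<exists>y\<in>S. \<forall>z\<in>S. J y \<le> J z"
proof -
  define I where "I = Inf (J ` S)"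
  have bdd: "bdd_below (J ` S)" using bound by (auto simp: bdd_below_def)
  have I: "I \<le> J z" if "z \<in> S" for z
    unfolding I_def using bdd that by (intro cInf_lower) auto
  have "\<exists>z\<in>S. J z < I + 1 / real (Suc n)" for n
  proof -
    have "Inf (J ` S) < I + 1 / real (Suc n)" by (simp add: I_def)
    then show ?thesis using cInf_lessD[of "J ` S"] S_0 by blast
  qed
  then obtain Y where Y: "\<And>n. Y n \<in> S" "\<And>n. J (Y n) < I + 1 / real (Suc n)" by metis
  have "Cauchy (\<lambda>n. Y n i)" if "i < M" for i
  proof (rule CauchyI)
    fix e :: real assume "0 < e"
    define k where "k = m / 4 * w i"
    have k: "0 < k" using w_pos[OF that] weight_0_pos by (simp add: k_def)
    \<comment> \<open>Both members exceed the infimum by less than \<open>1 / Suc n0\<close>, so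
      each is allotted half of \<open>k * e\<^sup>2\<close>.\<close>
    then obtain n0 where n0: "1 / real (Suc n0) < k * e\<^sup>2 / 2"
      using \<open>0 < e\<close> by (meson half_gt_zero_iff mult_pos_pos nat_approx_posE zero_less_power)
    show "\<exists>n0. \<forall>p\<ge>n0. \<forall>q\<ge>n0. norm (Y p i - Y q i) < e"
    proof (intro exI allI impI)
      fix p q assume pq: "n0 \<le> p" "n0 \<le> q"
      define z where "z = (\<lambda>i. 1 / 2 * Y p i + 1 / 2 * Y q i)"
      have "z \<in> S" unfolding z_def by (intro S_lincomb Y)
      have "w i * (Y p i - Y q i)\<^sup>2 \<le> (\<Sum>i<M. w i * (Y p i - Y q i)\<^sup>2)"
        using that w_pos by (intro member_le_sum) (auto intro!: mult_nonneg_nonneg simp: less_imp_le)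
      then have "k * (Y p i - Y q i)\<^sup>2 \<le> m / 4 * (\<Sum>i<M. w i * (Y p i - Y q i)\<^sup>2)"
        using weight_0_pos by (simp add: k_def)
      also have "\<dots> \<le> J (Y p) + J (Y q) - 2 * J z"
        using J_midpoint[of z "Y p" "Y q"] by (simp add: z_def)
      also have "\<dots> < 1 / real (Suc p) + 1 / real (Suc q)"
        using Y(2)[of p] Y(2)[of q] I[OF \<open>z \<in> S\<close>] by linarith
      also have "\<dots> \<le> 1 / real (Suc n0) + 1 / real (Suc n0)"
        using pq by (intro add_mono divide_left_mono) auto
      also have "\<dots> < k * e\<^sup>2" using n0 by linarith
      finally have "(Y p i - Y q i)\<^sup>2 < e\<^sup>2" using k by simp
      then show "norm (Y p i - Y q i) < e"
        using \<open>0 < e\<close> power2_less_imp_less[of "abs (Y p i - Y q i)" e] by simp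
    qed
  qed
  then have lim: "(\<lambda>n. Y n i) \<longlonglongrightarrow> lim (\<lambda>n. Y n i)" if "i < M" for i
    using that by (simp add: Cauchy_convergent_iff convergent_LIMSEQ_iff)
  define y where "y = (\<lambda>i. lim (\<lambda>n. Y n i))"
  have lim': "\<And>i. i < M \<Longrightarrow> (\<lambda>n. Y n i) \<longlonglongrightarrow> y i" using lim by (simp add: y_def)
  have "J y \<le> I"
  proof (rule LIMSEQ_le[OF J_tendsto[OF lim']])
    show "(\<lambda>n. I + 1 / real (Suc n)) \<longlonglongrightarrow> I"
      using tendsto_add[OF tendsto_const LIMSEQ_inverse_real_of_nat, of I]
      by (simp add: inverse_eq_divide)
  qed (use Y(2) in \<open>auto intro: less_imp_le\<close>)
  moreover have "y \<in> S" using Y(1) lim' by (rule S_closed)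
  ultimately show ?thesis using I by force
qed

lemma minimizer_critical:
  assumes "z \<in> S" "\<And>x. x \<in> S \<Longrightarrow> J z \<le> J x" "x \<in> S"
  shows "dJ z x = 0"
proof -
  have "(\<Sum>i<M. w i * (sgn (y0 i + z i) * (\<mu> (abs (y0 i + z i)) * abs (y0 i + z i))) * x i)
      = (\<Sum>i<M. h i * x i)"
  proof (rule euler_lagrange[where p="\<lambda>t. \<mu> t * t" and P=\<psi>, OF deriv_integrand])
    fix t
    have "J z \<le> J (\<lambda>i. 1 * z i + t * x i)" using assms by (intro assms(2) S_lincomb)
    then show "(\<Sum>i<M. w i * \<psi> (abs (y0 i + z i)))
        \<le> (\<Sum>i<M. w i * \<psi> (abs (y0 i + z i + t * x i))) - t * (\<Sum>i<M. h i * x i)"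
      by (simp add: J_def algebra_simps sum.distrib sum_distrib_left)
  qed simp_all
  then show ?thesis by (simp add: dJ_def even_deriv_eq)
qed

text \<open>The function \<open>d\<close> stands for the derivative of the original integrand, which
  is critical at \<open>z\<close>. The linear term then retains only the error of size
  \<open>q\<close> per entry, and strong convexity absorbs it by completing the square. As
  \<open>x\<close> is arbitrary in \<open>S\<close>, this also supplies the lower bound for
  \<open>ex_minimizer\<close>.\<close>

lemma J_gap:
  assumes "z \<in> S" "x \<in> S"
    and "\<And>i. i < M \<Longrightarrow> abs (\<mu> (abs (y0 i + z i)) * (y0 i + z i) - d i) \<le> q"
    and "\<And>x. x \<in> S \<Longrightarrow> (\<Sum>i<M. w i * d i * x i) = (\<Sum>i<M. h i * x i)"
  shows "J z - q\<^sup>2 / (2 * m) * (\<Sum>i<M. w i) \<le> J x"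
proof -
  define e where "e = (\<lambda>i. x i - z i)"
  have "e \<in> S" using assms S_diff by (simp add: e_def)
  then have "dJ z e = (\<Sum>i<M. w i * ((\<mu> (abs (y0 i + z i)) * (y0 i + z i) - d i) * e i))"
    using assms(4)[of e] by (simp add: dJ_def algebra_simps sum_subtractf)
  moreover have "- (q\<^sup>2 / (2 * m)) * (\<Sum>i<M. w i)
      \<le> (\<Sum>i<M. w i * ((\<mu> (abs (y0 i + z i)) * (y0 i + z i) - d i) * e i)) + m / 2 * (\<Sum>i<M. w i * (e i)\<^sup>2)"
  proof -
    have "- (q\<^sup>2 / (2 * m)) \<le> D * e i + m / 2 * (e i)\<^sup>2" if "abs D \<le> q" for D i
    proof -
      have "D\<^sup>2 \<le> q\<^sup>2" using that by (metis abs_ge_zero abs_le_square_iff abs_of_nonneg order_trans)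
      moreover have "0 \<le> (D + m * e i)\<^sup>2" by simp
      ultimately have "0 \<le> q\<^sup>2 + 2 * m * (D * e i) + m\<^sup>2 * (e i)\<^sup>2"
        by (simp add: power2_sum power_mult_distrib algebra_simps)
      also have "\<dots> = (2 * m) * (q\<^sup>2 / (2 * m) + D * e i + m / 2 * (e i)\<^sup>2)"
        using weight_0_pos by (simp add: field_simps power2_eq_square)
      finally show ?thesis using weight_0_pos by (simp add: zero_le_mult_iff)
    qed
    then have "(\<Sum>i<M. w i * - (q\<^sup>2 / (2 * m)))
      \<le> (\<Sum>i<M. w i * ((\<mu> (abs (y0 i + z i)) * (y0 i + z i) - d i) * e i + m / 2 * (e i)\<^sup>2))"
      using w_pos assms(3) by (intro sum_mono mult_left_mono) (auto intro: less_imp_le)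
    also have "\<dots> = (\<Sum>i<M. w i * ((\<mu> (abs (y0 i + z i)) * (y0 i + z i) - d i) * e i))
        + m / 2 * (\<Sum>i<M. w i * (e i)\<^sup>2)"
      by (simp add: distrib_left sum.distrib sum_distrib_left mult_ac)
    also have "(\<Sum>i<M. w i * - (q\<^sup>2 / (2 * m))) = - (q\<^sup>2 / (2 * m)) * (\<Sum>i<M. w i)"
      by (simp only: sum_distrib_right[symmetric] mult.commute)
    finally show ?thesis .
  qed
  ultimately show ?thesis
    using J_strongly_convex[of z x] by (simp add: e_def)
qed

lemma V_diff_le_J_diff:
  assumes "dJ z (\<lambda>i. x i - z i) = 0"
  shows "(\<Sum>i<M. w i * (V (y0 i + x i) - V (y0 i + z i))\<^sup>2) \<le> 16 * K ^ 3 * (J x - J z)"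
proof -
  have "(\<Sum>i<M. w i * (V (y0 i + x i) - V (y0 i + z i))\<^sup>2)
      \<le> (\<Sum>i<M. w i * (16 * K ^ 3 * (\<psi> (abs (y0 i + x i)) - \<psi> (abs (y0 i + z i))
        - \<mu> (abs (y0 i + z i)) * (y0 i + z i) * ((y0 i + x i) - (y0 i + z i)))))"
    using w_pos by (intro sum_mono mult_left_mono V_diff_le_bregman) (auto intro: less_imp_le)
  also have "\<dots> = 16 * K ^ 3 * (J x - J z - dJ z (\<lambda>i. x i - z i))"
    unfolding J_bregman by (simp only: sum_distrib_left mult_ac)
  finally show ?thesis using assms by simp
qed

section \<open>The dual energy and its minimiser\<close>

definition Jd :: "(nat \<Rightarrow> real) \<Rightarrow> real" where
  "Jd \<tau> = (\<Sum>i<M. w i * fenchel_conj \<psi> (abs (\<tau> i / w i))) - (\<Sum>i<M. \<tau> i * y0 i)"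

definition feasible :: "(nat \<Rightarrow> real) \<Rightarrow> bool" where
  "feasible \<tau> \<longleftrightarrow> (\<forall>x\<in>S. (\<Sum>i<M. \<tau> i * x i) = (\<Sum>i<M. h i * x i))"

text \<open>The dual variable belonging to \<open>z\<close>; at a critical point of \<open>J\<close>
  in \<open>S\<close> it is the dual minimiser, by \<open>flux_minimal\<close>.\<close>

definition flux :: "(nat \<Rightarrow> real) \<Rightarrow> nat \<Rightarrow> real" where
  "flux z i = w i * (\<mu> (abs (y0 i + z i)) * (y0 i + z i))"

lemma feasible_orth:
  assumes "feasible \<sigma>" "feasible \<tau>" "x \<in> S" shows "(\<Sum>i<M. x i * (\<tau> i - \<sigma> i)) = 0"
proof -
  have "(\<Sum>i<M. x i * (\<tau> i - \<sigma> i)) = (\<Sum>i<M. \<tau> i * x i) - (\<Sum>i<M. \<sigma> i * x i)"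
    by (simp add: right_diff_distrib sum_subtractf mult.commute)
  then show ?thesis using assms by (simp add: feasible_def)
qed

lemma flux_feasible: "(\<And>x. x \<in> S \<Longrightarrow> dJ z x = 0) \<Longrightarrow> feasible (flux z)"
  by (simp add: feasible_def flux_def dJ_def mult.assoc)

lemma conj_deriv_flux:
  assumes "i < M" shows "(flux z i / w i) / \<nu> (flux z i / w i) = y0 i + z i"
  using conj_deriv_of_deriv[of "y0 i + z i"] w_pos[OF assms] by (simp add: flux_def)

lemma Jd_strongly_convex:
  "Jd \<sigma> + (\<Sum>i<M. ((\<sigma> i / w i) / \<nu> (\<sigma> i / w i) - y0 i) * (\<tau> i - \<sigma> i))
    + (\<Sum>i<M. (\<tau> i - \<sigma> i)\<^sup>2 / w i) / (2 * \<Lambda>) \<le> Jd \<tau>"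
proof -
  have "w i * fenchel_conj \<psi> (abs (\<sigma> i / w i)) - \<sigma> i * y0 i
      + ((\<sigma> i / w i) / \<nu> (\<sigma> i / w i) - y0 i) * (\<tau> i - \<sigma> i) + (\<tau> i - \<sigma> i)\<^sup>2 / w i / (2 * \<Lambda>)
    \<le> w i * fenchel_conj \<psi> (abs (\<tau> i / w i)) - \<tau> i * y0 i" if "i < M" for i
  proof -
    define X where "X = (\<sigma> i / w i) / \<nu> (\<sigma> i / w i)"
    have w: "0 < w i" using w_pos that .
    have "w i * ((1 / \<Lambda>) / 2 * (\<tau> i / w i - \<sigma> i / w i)\<^sup>2) \<le> w i * (fenchel_conj \<psi> (abs (\<tau> i / w i))
        - fenchel_conj \<psi> (abs (\<sigma> i / w i)) - X * (\<tau> i / w i - \<sigma> i / w i))"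
      using w unfolding X_def by (intro mult_left_mono conj_bregman_even_lower) simp
    moreover have "\<tau> i / w i - \<sigma> i / w i = (\<tau> i - \<sigma> i) / w i" by (simp add: diff_divide_distrib)
    moreover have "w i * ((1 / \<Lambda>) / 2 * ((\<tau> i - \<sigma> i) / w i)\<^sup>2) = (\<tau> i - \<sigma> i)\<^sup>2 / w i / (2 * \<Lambda>)"
      using w by (simp add: power_divide power2_eq_square)
    moreover have "w i * (fenchel_conj \<psi> (abs (\<tau> i / w i))
        - fenchel_conj \<psi> (abs (\<sigma> i / w i)) - X * ((\<tau> i - \<sigma> i) / w i))
        = w i * fenchel_conj \<psi> (abs (\<tau> i / w i)) - w i * fenchel_conj \<psi> (abs (\<sigma> i / w i)) - X * (\<tau> i - \<sigma> i)"
      using w by (simp only: right_diff_distrib[of "w i"]) simp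
    ultimately show ?thesis unfolding X_def[symmetric] by (simp add: left_diff_distrib right_diff_distrib)
  qed
  then have "(\<Sum>i<M. w i * fenchel_conj \<psi> (abs (\<sigma> i / w i)) - \<sigma> i * y0 i
      + ((\<sigma> i / w i) / \<nu> (\<sigma> i / w i) - y0 i) * (\<tau> i - \<sigma> i) + (\<tau> i - \<sigma> i)\<^sup>2 / w i / (2 * \<Lambda>))
    \<le> (\<Sum>i<M. w i * fenchel_conj \<psi> (abs (\<tau> i / w i)) - \<tau> i * y0 i)"
    by (intro sum_mono) simp
  then show ?thesis by (simp only: Jd_def sum.distrib sum_subtractf sum_divide_distrib)
qed

text \<open>At the flux the gradient of \<open>Jd\<close> is \<open>z\<close>: the conjugate
  derivative returns \<open>y0 + z\<close> and the linear term removes \<open>y0\<close>. Since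
  \<open>z\<close> lies in \<open>S\<close>, it is orthogonal to differences of feasible points, and
  only the quadratic term of strong convexity is left.\<close>

lemma flux_growth:
  assumes z: "z \<in> S" "\<And>x. x \<in> S \<Longrightarrow> dJ z x = 0" and "feasible \<tau>"
  shows "(\<Sum>i<M. (\<tau> i - flux z i)\<^sup>2 / w i) \<le> 2 * \<Lambda> * (Jd \<tau> - Jd (flux z))"
proof -
  have "(\<Sum>i<M. ((flux z i / w i) / \<nu> (flux z i / w i) - y0 i) * (\<tau> i - flux z i))
      = (\<Sum>i<M. z i * (\<tau> i - flux z i))"
  proof (intro sum.cong refl)
    fix i assume "i \<in> {..<M}"
    then show "((flux z i / w i) / \<nu> (flux z i / w i) - y0 i) * (\<tau> i - flux z i) = z i * (\<tau> i - flux z i)"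
      by (subst conj_deriv_flux) simp_all
  qed
  also have "\<dots> = 0" using feasible_orth[OF flux_feasible[OF z(2)] \<open>feasible \<tau>\<close> z(1)] .
  finally have "(\<Sum>i<M. (\<tau> i - flux z i)\<^sup>2 / w i) / (2 * \<Lambda>) \<le> Jd \<tau> - Jd (flux z)"
    using Jd_strongly_convex[of "flux z" \<tau>] by linarith
  then show ?thesis
    using \<Lambda>_pos pos_divide_le_eq[of "2 * \<Lambda>"] by (simp only: mult.commute[of "2 * \<Lambda>"])
qed

lemma flux_minimal:
  assumes z: "z \<in> S" "\<And>x. x \<in> S \<Longrightarrow> dJ z x = 0" and "feasible \<tau>"
  shows "Jd (flux z) \<le> Jd \<tau>"
proof -
  have "0 \<le> (\<Sum>i<M. (\<tau> i - flux z i)\<^sup>2 / w i)"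
    using w_pos by (intro sum_nonneg divide_nonneg_pos) auto
  also have "\<dots> \<le> 2 * \<Lambda> * (Jd \<tau> - Jd (flux z))" using assms by (rule flux_growth)
  finally show ?thesis using \<Lambda>_pos by (simp add: zero_le_mult_iff)
qed

section \<open>One step of the scheme and its contraction\<close>

definition irls_weight :: "(nat \<Rightarrow> real) \<Rightarrow> nat \<Rightarrow> real" where
  "irls_weight \<sigma> i = w i * \<nu> (\<sigma> i / w i)"

lemma irls_weight_pos: "i < M \<Longrightarrow> 0 < irls_weight \<sigma> i"
  using w_pos \<nu>_pos by (simp add: irls_weight_def)

lemma irls_weight_ge: "i < M \<Longrightarrow> w i * m \<le> irls_weight \<sigma> i"
  using w_pos \<nu>_ge by (simp add: irls_weight_def mult_left_mono less_imp_le)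

lemma Jd_majorant:
  "Jd \<tau> \<le> Jd \<sigma> + (\<Sum>i<M. ((\<tau> i)\<^sup>2 - (\<sigma> i)\<^sup>2) / (2 * irls_weight \<sigma> i)) - (\<Sum>i<M. y0 i * (\<tau> i - \<sigma> i))"
proof -
  have "w i * fenchel_conj \<psi> (abs (\<tau> i / w i)) \<le> w i * fenchel_conj \<psi> (abs (\<sigma> i / w i))
      + ((\<tau> i)\<^sup>2 - (\<sigma> i)\<^sup>2) / (2 * irls_weight \<sigma> i)" if "i < M" for i
  proof -
    have w: "0 < w i" using w_pos that .
    have "w i * fenchel_conj \<psi> (abs (\<tau> i / w i)) \<le> w i * (fenchel_conj \<psi> (abs (\<sigma> i / w i))
        + ((\<tau> i / w i)\<^sup>2 - (\<sigma> i / w i)\<^sup>2) / (2 * \<nu> (\<sigma> i / w i)))"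
      using w by (intro mult_left_mono fenchel_conj_majorant) simp
    moreover have "w i * (((\<tau> i / w i)\<^sup>2 - (\<sigma> i / w i)\<^sup>2) / (2 * \<nu> (\<sigma> i / w i)))
        = ((\<tau> i)\<^sup>2 - (\<sigma> i)\<^sup>2) / (2 * irls_weight \<sigma> i)"
      using w by (simp add: irls_weight_def power_divide power2_eq_square flip: diff_divide_distrib)
    ultimately show ?thesis by (simp only: distrib_left)
  qed
  then have "(\<Sum>i<M. w i * fenchel_conj \<psi> (abs (\<tau> i / w i))) \<le> (\<Sum>i<M. w i * fenchel_conj \<psi> (abs (\<sigma> i / w i))
      + ((\<tau> i)\<^sup>2 - (\<sigma> i)\<^sup>2) / (2 * irls_weight \<sigma> i))"
    by (intro sum_mono) simp
  then show ?thesis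
    by (simp add: Jd_def sum.distrib algebra_simps sum_subtractf)
qed

text \<open>The gradient of the majorant at the new iterate,
  \<open>\<sigma>' i / irls_weight \<sigma> i - y0 i\<close>, equals \<open>x i\<close>. As
  \<open>x\<close> is in \<open>S\<close>, this is orthogonal to feasible directions, so the new
  iterate minimises the convex majorant.\<close>

lemma irls_step_optimal:
  assumes "x \<in> S" and "feasible \<sigma>'" "feasible \<tau>"
    and \<sigma>': "\<And>i. i < M \<Longrightarrow> \<sigma>' i = irls_weight \<sigma> i * (y0 i + x i)"
  shows "Jd \<sigma>' \<le> Jd \<sigma> + (\<Sum>i<M. ((\<tau> i)\<^sup>2 - (\<sigma> i)\<^sup>2) / (2 * irls_weight \<sigma> i)) - (\<Sum>i<M. y0 i * (\<tau> i - \<sigma> i))"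
proof -
  have "y0 i * (\<tau> i - \<sigma>' i) + x i * (\<tau> i - \<sigma>' i)
      \<le> ((\<tau> i)\<^sup>2 - (\<sigma> i)\<^sup>2) / (2 * irls_weight \<sigma> i) - ((\<sigma>' i)\<^sup>2 - (\<sigma> i)\<^sup>2) / (2 * irls_weight \<sigma> i)"
    if "i < M" for i
  proof -
    let ?a = "irls_weight \<sigma> i"
    have a: "0 < ?a" using irls_weight_pos that .
    have "y0 i * (\<tau> i - \<sigma>' i) + x i * (\<tau> i - \<sigma>' i) = \<sigma>' i * (\<tau> i - \<sigma>' i) / ?a"
    proof -
      have "y0 i + x i = \<sigma>' i / ?a" using a \<sigma>'[OF that] by simp
      then show ?thesis by (simp flip: distrib_right)
    qed
    also have "\<dots> = (2 * (\<sigma>' i * (\<tau> i - \<sigma>' i))) / (2 * ?a)" by simp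
    also have "\<dots> \<le> ((\<tau> i)\<^sup>2 - (\<sigma>' i)\<^sup>2) / (2 * ?a)"
      using a sum_squares_bound[of "\<tau> i" "\<sigma>' i"]
      by (intro divide_right_mono) (simp_all add: power2_eq_square algebra_simps)
    finally show ?thesis by (simp flip: diff_divide_distrib)
  qed
  then have "(\<Sum>i<M. y0 i * (\<tau> i - \<sigma>' i) + x i * (\<tau> i - \<sigma>' i))
      \<le> (\<Sum>i<M. ((\<tau> i)\<^sup>2 - (\<sigma> i)\<^sup>2) / (2 * irls_weight \<sigma> i) - ((\<sigma>' i)\<^sup>2 - (\<sigma> i)\<^sup>2) / (2 * irls_weight \<sigma> i))"
    by (intro sum_mono) simp
  then have "(\<Sum>i<M. y0 i * (\<tau> i - \<sigma>' i))
      \<le> (\<Sum>i<M. ((\<tau> i)\<^sup>2 - (\<sigma> i)\<^sup>2) / (2 * irls_weight \<sigma> i)) - (\<Sum>i<M. ((\<sigma>' i)\<^sup>2 - (\<sigma> i)\<^sup>2) / (2 * irls_weight \<sigma> i))"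
    using feasible_orth[OF assms(2,3,1)] by (simp only: sum.distrib sum_subtractf add_0_right)
  moreover have "(\<Sum>i<M. y0 i * (\<tau> i - \<sigma>' i)) = (\<Sum>i<M. y0 i * (\<tau> i - \<sigma> i)) - (\<Sum>i<M. y0 i * (\<sigma>' i - \<sigma> i))"
    by (simp add: algebra_simps sum_subtractf)
  ultimately show ?thesis using Jd_majorant[of \<sigma>' \<sigma>] by linarith
qed

text \<open>The comparison in \<open>irls_step_contraction\<close> would bear
  \<open>m / \<Lambda>\<close>, but that is 1 when \<open>m = \<Lambda>\<close>; halving keeps the
  rate strictly below 1.\<close>

definition rate :: real where "rate = m / (2 * \<Lambda>)"

lemma rate_bounds: "0 < rate" "rate < 1"
  using weight_0_pos \<Lambda>_pos m_le_\<Lambda> by (auto simp: rate_def field_simps)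

text \<open>Moving the fraction \<open>rate\<close> towards \<open>\<sigma>d\<close> scales the
  linear term of the majorant by \<open>rate\<close> and the quadratic one by its square. The spare
  factor brings the curvature of the majorant, at most \<open>1 / (w i * m)\<close>, below the
  curvature \<open>1 / (w i * \<Lambda>)\<close> of strong convexity.\<close>

lemma irls_step_contraction:
  assumes "x \<in> S" and \<sigma>: "feasible \<sigma>" and "feasible \<sigma>'" and \<sigma>d: "feasible \<sigma>d"
    and \<sigma>': "\<And>i. i < M \<Longrightarrow> \<sigma>' i = irls_weight \<sigma> i * (y0 i + x i)"
  shows "Jd \<sigma>' - Jd \<sigma>d \<le> (1 - rate) * (Jd \<sigma> - Jd \<sigma>d)"
proof -
  define e where "e = (\<lambda>i. \<sigma>d i - \<sigma> i)"
  define \<tau> where "\<tau> = (\<lambda>i. \<sigma> i + rate * e i)"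
  have "feasible \<tau>"
  proof -
    have "(\<Sum>i<M. \<tau> i * v i) = (\<Sum>i<M. h i * v i)" if "v \<in> S" for v
    proof -
      have "(\<Sum>i<M. \<tau> i * v i) = (\<Sum>i<M. \<sigma> i * v i) + rate * (\<Sum>i<M. v i * (\<sigma>d i - \<sigma> i))"
        unfolding \<tau>_def e_def sum_distrib_left sum.distrib[symmetric]
        by (intro sum.cong) (simp_all add: algebra_simps)
      then show ?thesis using feasible_orth[OF \<sigma> \<sigma>d that] \<sigma> that by (simp add: feasible_def)
    qed
    then show ?thesis by (simp add: feasible_def)
  qed
  have "((\<tau> i)\<^sup>2 - (\<sigma> i)\<^sup>2) / (2 * irls_weight \<sigma> i) - y0 i * (\<tau> i - \<sigma> i)
      \<le> rate * (((\<sigma> i / w i) / \<nu> (\<sigma> i / w i) - y0 i) * e i + (e i)\<^sup>2 / w i / (2 * \<Lambda>))" if "i < M" for i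
  proof -
    let ?a = "irls_weight \<sigma> i"
    have w: "0 < w i" using w_pos that .
    have a: "0 < ?a" "w i * m \<le> ?a" using irls_weight_pos irls_weight_ge that by auto
    have "rate / (2 * ?a) \<le> rate / (2 * (w i * m))"
      using a rate_bounds w weight_0_pos by (intro divide_left_mono mult_pos_pos) auto
    also have "\<dots> = 1 / (4 * (w i * \<Lambda>))" using weight_0_pos by (simp add: rate_def)
    also have "\<dots> \<le> 1 / (2 * (w i * \<Lambda>))" proof -
      have "1 / (4 * c) \<le> 1 / (2 * c)" if "0 < c" for c :: real
        using that by (simp add: field_simps)
      then show ?thesis using mult_pos_pos[OF w \<Lambda>_pos] by blast
    qed
    finally have "rate / (2 * ?a) * (e i)\<^sup>2 \<le> 1 / (2 * (w i * \<Lambda>)) * (e i)\<^sup>2"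
      by (intro mult_right_mono) auto
    then have *: "rate / (2 * ?a) * (e i)\<^sup>2 \<le> (e i)\<^sup>2 / w i / (2 * \<Lambda>)" by (simp add: mult_ac)
    have "((\<tau> i)\<^sup>2 - (\<sigma> i)\<^sup>2) / (2 * ?a) = rate * (\<sigma> i / ?a * e i + rate / (2 * ?a) * (e i)\<^sup>2)"
      using a by (simp add: \<tau>_def field_simps power2_eq_square)
    moreover have "\<sigma> i / ?a = (\<sigma> i / w i) / \<nu> (\<sigma> i / w i)" by (simp add: irls_weight_def)
    moreover have "y0 i * (\<tau> i - \<sigma> i) = rate * (y0 i * e i)" by (simp add: \<tau>_def)
    ultimately have "((\<tau> i)\<^sup>2 - (\<sigma> i)\<^sup>2) / (2 * ?a) - y0 i * (\<tau> i - \<sigma> i)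
       = rate * (((\<sigma> i / w i) / \<nu> (\<sigma> i / w i) - y0 i) * e i + rate / (2 * ?a) * (e i)\<^sup>2)"
      by (simp add: algebra_simps)
    also have "\<dots> \<le> rate * (((\<sigma> i / w i) / \<nu> (\<sigma> i / w i) - y0 i) * e i + (e i)\<^sup>2 / w i / (2 * \<Lambda>))"
      using * rate_bounds by (intro mult_left_mono add_left_mono) auto
    finally show ?thesis .
  qed
  then have "(\<Sum>i<M. ((\<tau> i)\<^sup>2 - (\<sigma> i)\<^sup>2) / (2 * irls_weight \<sigma> i) - y0 i * (\<tau> i - \<sigma> i))
      \<le> (\<Sum>i<M. rate * (((\<sigma> i / w i) / \<nu> (\<sigma> i / w i) - y0 i) * e i + (e i)\<^sup>2 / w i / (2 * \<Lambda>)))"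
    by (intro sum_mono) simp
  also have "\<dots> = rate * ((\<Sum>i<M. ((\<sigma> i / w i) / \<nu> (\<sigma> i / w i) - y0 i) * e i) + (\<Sum>i<M. (e i)\<^sup>2 / w i) / (2 * \<Lambda>))"
    by (simp only: sum_distrib_left[symmetric] sum.distrib sum_divide_distrib)
  also have "\<dots> \<le> rate * (Jd \<sigma>d - Jd \<sigma>)"
    using Jd_strongly_convex[of \<sigma> \<sigma>d] rate_bounds unfolding e_def by (intro mult_left_mono) auto
  finally show ?thesis
    using irls_step_optimal[OF assms(1,3) \<open>feasible \<tau>\<close> \<sigma>'] by (simp add: sum_subtractf algebra_simps)
qed

text \<open>The new primal point divides \<open>\<sigma>'\<close> by the weights of
  \<open>\<sigma>\<close>. Its error splits into \<open>A\<close> and \<open>B\<close>, which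
  replace \<open>\<sigma>'\<close> by the flux and the flux by \<open>\<sigma>\<close> under fixed
  weights, and \<open>C\<close>, the change of the conjugate derivative from the flux to
  \<open>\<sigma>\<close>. All three are controlled with the factor \<open>1 / m\<close>.\<close>

lemma irls_step_distance:
  assumes z: "z \<in> S" "\<And>x. x \<in> S \<Longrightarrow> dJ z x = 0"
    and "x \<in> S" "feasible \<sigma>" "feasible \<sigma>'"
    and \<sigma>': "\<And>i. i < M \<Longrightarrow> \<sigma>' i = irls_weight \<sigma> i * (y0 i + x i)"
  shows "(\<Sum>i<M. w i * (x i - z i)\<^sup>2) \<le> 18 * \<Lambda> / m\<^sup>2 * (Jd \<sigma> - Jd (flux z))"
proof -
  let ?d = "flux z"
  have "w i * (x i - z i)\<^sup>2 \<le> 3 / m\<^sup>2 * ((\<sigma>' i - ?d i)\<^sup>2 / w i + 2 * ((\<sigma> i - ?d i)\<^sup>2 / w i))" if "i < M" for i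
  proof -
    let ?a = "irls_weight \<sigma> i"
    have w: "0 < w i" using w_pos that .
    have a: "0 < ?a" "w i * m \<le> ?a" using irls_weight_pos irls_weight_ge that by auto
    have quot: "abs (t / ?a) \<le> abs t / (w i * m)" for t
    proof -
      have "abs (t / ?a) = abs t / ?a" using a by simp
      also have "\<dots> \<le> abs t / (w i * m)"
        using a w weight_0_pos by (intro divide_left_mono mult_pos_pos) auto
      finally show ?thesis .
    qed
    define A where "A = (\<sigma>' i - ?d i) / ?a"
    define B where "B = (?d i - \<sigma> i) / ?a"
    define C where "C = (\<sigma> i / w i) / \<nu> (\<sigma> i / w i) - (?d i / w i) / \<nu> (?d i / w i)"
    have "y0 i + x i = \<sigma>' i / ?a" using \<sigma>'[OF that] a by simp
    moreover have "(\<sigma> i / w i) / \<nu> (\<sigma> i / w i) = \<sigma> i / ?a"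
      unfolding irls_weight_def by simp
    moreover have "(?d i / w i) / \<nu> (?d i / w i) = y0 i + z i" using conj_deriv_flux[OF that] .
    ultimately have eq: "x i - z i = A + B + C"
      unfolding A_def B_def C_def by (simp only: diff_divide_distrib)
    define P where "P = abs (\<sigma>' i - ?d i) / (w i * m)"
    define Q where "Q = abs (\<sigma> i - ?d i) / (w i * m)"
    have "abs A \<le> P" using quot unfolding A_def P_def .
    moreover have "abs B \<le> Q" using quot[of "?d i - \<sigma> i"] unfolding B_def Q_def by (simp add: abs_minus_commute)
    moreover have "abs C \<le> Q"
      using conj_deriv_lipschitz[of "\<sigma> i / w i" "?d i / w i"] w
      unfolding C_def Q_def by (simp flip: diff_divide_distrib)
    ultimately have "abs (x i - z i) \<le> P + 2 * Q" unfolding eq by linarith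
    then have "(x i - z i)\<^sup>2 \<le> (P + 2 * Q)\<^sup>2" by (metis abs_ge_zero power2_abs power_mono)
    \<comment> \<open>Cauchy-Schwarz for the three summands \<open>P\<close>, \<open>Q\<close> and
      \<open>Q\<close>.\<close>
    also have "\<dots> \<le> 3 * (P\<^sup>2 + 2 * Q\<^sup>2)"
      using sum_squares_bound[of P Q] by (simp add: power2_eq_square algebra_simps)
    finally have "w i * (x i - z i)\<^sup>2 \<le> w i * (3 * (P\<^sup>2 + 2 * Q\<^sup>2))"
      using w by (intro mult_left_mono) auto
    also have "w i * P\<^sup>2 = (\<sigma>' i - ?d i)\<^sup>2 / w i / m\<^sup>2" "w i * Q\<^sup>2 = (\<sigma> i - ?d i)\<^sup>2 / w i / m\<^sup>2"
      using w by (simp_all add: P_def Q_def power_divide power_mult_distrib power2_eq_square)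
    then have "w i * (3 * (P\<^sup>2 + 2 * Q\<^sup>2)) = 3 * ((\<sigma>' i - ?d i)\<^sup>2 / w i / m\<^sup>2 + 2 * ((\<sigma> i - ?d i)\<^sup>2 / w i / m\<^sup>2))"
      by (simp add: distrib_left mult_ac)
    finally show ?thesis by (simp add: distrib_left mult.commute[of "m\<^sup>2"])
  qed
  then have "(\<Sum>i<M. w i * (x i - z i)\<^sup>2)
      \<le> (\<Sum>i<M. 3 / m\<^sup>2 * ((\<sigma>' i - ?d i)\<^sup>2 / w i + 2 * ((\<sigma> i - ?d i)\<^sup>2 / w i)))"
    by (intro sum_mono) simp
  also have "\<dots> = 3 / m\<^sup>2 * ((\<Sum>i<M. (\<sigma>' i - ?d i)\<^sup>2 / w i) + 2 * (\<Sum>i<M. (\<sigma> i - ?d i)\<^sup>2 / w i))"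
    by (simp only: sum_distrib_left[symmetric] sum.distrib)
  also have "\<dots> \<le> 3 / m\<^sup>2 * (2 * \<Lambda> * (Jd \<sigma>' - Jd ?d) + 2 * (2 * \<Lambda> * (Jd \<sigma> - Jd ?d)))"
    using flux_growth[OF z \<open>feasible \<sigma>\<close>] flux_growth[OF z \<open>feasible \<sigma>'\<close>]
    by (intro mult_left_mono add_mono) simp_all
  \<comment> \<open>The contraction bounds the gap at \<open>\<sigma>'\<close> by the gap at
    \<open>\<sigma>\<close>, so the multiples 2 and 4 of \<Lambda> add up; the factor 3 makes
    18.\<close>
  also have "\<dots> \<le> 3 / m\<^sup>2 * (2 * \<Lambda> * (Jd \<sigma> - Jd ?d) + 2 * (2 * \<Lambda> * (Jd \<sigma> - Jd ?d)))"
  proof -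
    have "Jd \<sigma>' - Jd ?d \<le> (1 - rate) * (Jd \<sigma> - Jd ?d)"
      using assms flux_feasible[OF z(2)] by (intro irls_step_contraction)
    also have "\<dots> \<le> 1 * (Jd \<sigma> - Jd ?d)"
      using rate_bounds flux_minimal[OF z \<open>feasible \<sigma>\<close>] by (intro mult_right_mono) auto
    finally show ?thesis using \<Lambda>_pos by (intro mult_left_mono add_mono) auto
  qed
  also have "\<dots> = 18 * \<Lambda> / m\<^sup>2 * (Jd \<sigma> - Jd ?d)" by simp
  finally show ?thesis .
qed

lemma irls_step_V_distance:
  assumes z: "z \<in> S" "\<And>x. x \<in> S \<Longrightarrow> dJ z x = 0"
    and "x \<in> S" "feasible \<sigma>" "feasible \<sigma>'"
    and \<sigma>': "\<And>i. i < M \<Longrightarrow> \<sigma>' i = irls_weight \<sigma> i * (y0 i + x i)"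
  shows "(\<Sum>i<M. w i * (V (y0 i + x i) - V (y0 i + z i))\<^sup>2)
    \<le> 16 * K ^ 3 * (9 * \<Lambda>\<^sup>2 / m\<^sup>2 * (Jd \<sigma> - Jd (flux z)))"
proof -
  have K: "0 < K" using K_ge_1 by simp
  have "(V (y0 i + x i) - V (y0 i + z i))\<^sup>2 \<le> 16 * K ^ 3 * (\<Lambda> / 2 * (x i - z i)\<^sup>2)" for i
  proof -
    have "(V (y0 i + x i) - V (y0 i + z i))\<^sup>2 \<le> 16 * K ^ 3 * (\<psi> (abs (y0 i + x i)) - \<psi> (abs (y0 i + z i))
        - \<mu> (abs (y0 i + z i)) * (y0 i + z i) * ((y0 i + x i) - (y0 i + z i)))"
      by (rule V_diff_le_bregman)
    also have "\<dots> \<le> 16 * K ^ 3 * (\<Lambda> / 2 * ((y0 i + x i) - (y0 i + z i))\<^sup>2)"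
      using K by (intro mult_left_mono bregman_even_upper) simp
    finally show ?thesis by simp
  qed
  then have "(\<Sum>i<M. w i * (V (y0 i + x i) - V (y0 i + z i))\<^sup>2)
      \<le> (\<Sum>i<M. w i * (16 * K ^ 3 * (\<Lambda> / 2 * (x i - z i)\<^sup>2)))"
    using w_pos by (intro sum_mono mult_left_mono) (auto intro: less_imp_le)
  also have "\<dots> = 16 * K ^ 3 * (\<Lambda> / 2 * (\<Sum>i<M. w i * (x i - z i)\<^sup>2))"
    by (simp only: sum_distrib_left mult_ac)
  also have "\<dots> \<le> 16 * K ^ 3 * (\<Lambda> / 2 * (18 * \<Lambda> / m\<^sup>2 * (Jd \<sigma> - Jd (flux z))))"
    using irls_step_distance[OF assms] K \<Lambda>_pos by (intro mult_left_mono) auto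
  also have "\<Lambda> / 2 * (18 * \<Lambda> / m\<^sup>2 * (Jd \<sigma> - Jd (flux z))) = 9 * \<Lambda>\<^sup>2 / m\<^sup>2 * (Jd \<sigma> - Jd (flux z))"
    by (simp add: power2_eq_square)
  finally show ?thesis .
qed

text \<open>The primal iterate is controlled by the dual energy one step earlier, at
  \<open>\<sigma> k\<close> with \<open>n = Suc k\<close>. Restoring the power \<open>n\<close>
  costs the factor \<open>1 / (1 - rate)\<close> in the constant.\<close>

lemma irls_convergence:
  assumes z: "z \<in> S" "\<And>x. x \<in> S \<Longrightarrow> dJ z x = 0"
    and x: "\<And>n. x (Suc n) \<in> S" and \<sigma>: "\<And>n. feasible (\<sigma> n)"
    and step: "\<And>n i. i < M \<Longrightarrow> \<sigma> (Suc n) i = irls_weight (\<sigma> n) i * (y0 i + x (Suc n) i)"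
    and z1: "z1 \<in> S" "J z1 - J z \<le> \<epsilon>" and "1 \<le> n"
  shows "(\<Sum>i<M. w i * (V (y0 i + z1 i) - V (y0 i + x n i))\<^sup>2)
    \<le> 32 * K ^ 3 * (\<epsilon> + 9 * \<Lambda>\<^sup>2 / m\<^sup>2 / (1 - rate) * (1 - rate) ^ n * (Jd (\<sigma> 0) - Jd (flux z)))"
proof -
  have K: "0 < K" using K_ge_1 by simp
  obtain k where k: "n = Suc k" using \<open>1 \<le> n\<close> by (cases n) auto
  have decay: "Jd (\<sigma> j) - Jd (flux z) \<le> (1 - rate) ^ j * (Jd (\<sigma> 0) - Jd (flux z))" for j
  proof (induction j)
    case (Suc j)
    have "Jd (\<sigma> (Suc j)) - Jd (flux z) \<le> (1 - rate) * (Jd (\<sigma> j) - Jd (flux z))"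
      using irls_step_contraction[OF x \<sigma> \<sigma> flux_feasible[OF z(2)] step] .
    also have "\<dots> \<le> (1 - rate) * ((1 - rate) ^ j * (Jd (\<sigma> 0) - Jd (flux z)))"
      using Suc rate_bounds by (intro mult_left_mono) auto
    finally show ?case by simp
  qed simp
  have dJ: "dJ z (\<lambda>i. z1 i - z i) = 0" using z z1 by (intro z(2) S_diff)
  define A where "A = (\<lambda>i. V (y0 i + z1 i) - V (y0 i + z i))"
  define B where "B = (\<lambda>i. V (y0 i + x n i) - V (y0 i + z i))"
  have 1: "(\<Sum>i<M. w i * (A i)\<^sup>2) \<le> 16 * K ^ 3 * \<epsilon>"
  proof -
    have "(\<Sum>i<M. w i * (A i)\<^sup>2) \<le> 16 * K ^ 3 * (J z1 - J z)"
      unfolding A_def by (rule V_diff_le_J_diff[OF dJ])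
    also have "\<dots> \<le> 16 * K ^ 3 * \<epsilon>" using z1 K by (intro mult_left_mono) auto
    finally show ?thesis .
  qed
  have 2: "(\<Sum>i<M. w i * (B i)\<^sup>2) \<le> 16 * K ^ 3 * (9 * \<Lambda>\<^sup>2 / m\<^sup>2 * ((1 - rate) ^ k * (Jd (\<sigma> 0) - Jd (flux z))))"
  proof -
    have "(\<Sum>i<M. w i * (B i)\<^sup>2) \<le> 16 * K ^ 3 * (9 * \<Lambda>\<^sup>2 / m\<^sup>2 * (Jd (\<sigma> k) - Jd (flux z)))"
      unfolding B_def k by (rule irls_step_V_distance[OF z x \<sigma> \<sigma> step])
    also have "\<dots> \<le> 16 * K ^ 3 * (9 * \<Lambda>\<^sup>2 / m\<^sup>2 * ((1 - rate) ^ k * (Jd (\<sigma> 0) - Jd (flux z))))"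
      using K decay by (intro mult_left_mono) auto
    finally show ?thesis .
  qed
  have "(\<Sum>i<M. w i * (V (y0 i + z1 i) - V (y0 i + x n i))\<^sup>2) \<le> (\<Sum>i<M. w i * (2 * (A i)\<^sup>2 + 2 * (B i)\<^sup>2))"
  proof (intro sum_mono mult_left_mono)
    fix i
    have "(V (y0 i + z1 i) - V (y0 i + x n i))\<^sup>2 = (A i - B i)\<^sup>2" by (simp add: A_def B_def)
    also have "\<dots> \<le> 2 * (A i)\<^sup>2 + 2 * (B i)\<^sup>2"
      using sum_squares_bound[of "A i" "- B i"] by (simp add: power2_diff)
    finally show "(V (y0 i + z1 i) - V (y0 i + x n i))\<^sup>2 \<le> 2 * (A i)\<^sup>2 + 2 * (B i)\<^sup>2" .
  qed (use w_pos in \<open>auto intro: less_imp_le\<close>)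
  also have "\<dots> = 2 * (\<Sum>i<M. w i * (A i)\<^sup>2) + 2 * (\<Sum>i<M. w i * (B i)\<^sup>2)"
    by (simp add: distrib_left sum.distrib sum_distrib_left mult_ac)
  also have "\<dots> \<le> 2 * (16 * K ^ 3 * \<epsilon>)
      + 2 * (16 * K ^ 3 * (9 * \<Lambda>\<^sup>2 / m\<^sup>2 * ((1 - rate) ^ k * (Jd (\<sigma> 0) - Jd (flux z)))))"
    using 1 2 by (intro add_mono mult_left_mono) auto
  also have "(1 - rate) ^ k = (1 - rate) ^ n / (1 - rate)" using rate_bounds by (simp add: k)
  also have "2 * (16 * K ^ 3 * \<epsilon>)
      + 2 * (16 * K ^ 3 * (9 * \<Lambda>\<^sup>2 / m\<^sup>2 * ((1 - rate) ^ n / (1 - rate) * (Jd (\<sigma> 0) - Jd (flux z)))))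
    = 32 * K ^ 3 * (\<epsilon> + 9 * \<Lambda>\<^sup>2 / m\<^sup>2 / (1 - rate) * (1 - rate) ^ n * (Jd (\<sigma> 0) - Jd (flux z)))"
    by (simp add: distrib_left)
  finally show ?thesis .
qed

end

section \<open>The regularized integrand\<close>

text \<open>Since the quotient is nondecreasing, clamping its value is the same as clamping its
  argument.\<close>

lemma phi_reg'_eq_clamp:
  assumes "0 < a" "a \<le> b" "0 \<le> t"
    and mono: "\<And>t T. 0 < t \<Longrightarrow> t \<le> T \<Longrightarrow> \<phi>' t / t \<le> \<phi>' T / T"
  defines "c \<equiv> max a (min t b)"
  shows "phi_reg' \<phi>' a b t = \<phi>' c / c * t"
proof -
  have "min (max (\<phi>' a / a) (\<phi>' t / t)) (\<phi>' b / b) = \<phi>' c / c" if "t \<noteq> 0"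
  proof -
    have "0 < t" using that assms by simp
    consider "t \<le> a" | "a \<le> t" "t \<le> b" | "b \<le> t" by linarith
    then show ?thesis
      using mono[OF \<open>0 < t\<close>, of a] mono[OF \<open>0 < a\<close>, of t] mono[OF \<open>0 < t\<close>, of b] mono[OF \<open>0 < a\<close>, of b]
        mono[of b t] assms(1,2) unfolding c_def
      by cases (simp_all add: min_def max_def)
  qed
  then show ?thesis by (simp add: phi_reg'_def)
qed

locale uniformly_convex_N_function =
  fixes \<phi> \<phi>' :: "real \<Rightarrow> real" and k1 k2 :: real
  assumes N_function: "N_function \<phi> \<phi>'"
    and uniformly_convex: "uniformly_convex_fun k1 k2 \<phi>'"
    and quotient_mono: "0 < t \<Longrightarrow> t \<le> T \<Longrightarrow> \<phi>' t / t \<le> \<phi>' T / T"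
begin

lemma derivative_0: "\<phi>' 0 = 0" and derivative_pos: "0 < t \<Longrightarrow> 0 < \<phi>' t"
  and derivative_mono: "0 \<le> s \<Longrightarrow> s \<le> t \<Longrightarrow> \<phi>' s \<le> \<phi>' t"
  using N_function by (auto simp: N_function_def mono_on_def)

lemma derivative_diff_le:
  assumes "0 \<le> s" "s < t" shows "\<phi>' t - \<phi>' s \<le> k2 * (\<phi>' t / t) * (t - s)"
proof -
  have "(\<phi>' s - \<phi>' t) / (s - t) \<le> k2 * (\<phi>' t / t)"
    using uniformly_convex assms by (simp add: uniformly_convex_fun_def)
  moreover have "(\<phi>' s - \<phi>' t) / (s - t) = (\<phi>' t - \<phi>' s) / (t - s)"
    by (metis minus_diff_eq minus_divide_divide)
  ultimately show ?thesis using assms by (simp add: pos_divide_le_eq)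
qed

lemma k2_ge_1: "1 \<le> k2"
  using derivative_diff_le[of 0 1] derivative_pos[of 1] derivative_0 by simp

text \<open>The definition of an N-function grants right continuity only. The upper uniform
  convexity bound makes the derivative Lipschitz on each \<open>{0..b}\<close>, with the largest
  quotient at \<open>b\<close>; the fundamental theorem of calculus needs the continuity.\<close>

lemma derivative_continuous: "continuous_on {0..} \<phi>'"
proof -
  have cont: "continuous_on {0..b} \<phi>'" if "0 < b" for b
  proof (rule lipschitz_on_continuous_on)
    let ?C = "k2 * (\<phi>' b / b)"
    have C: "0 \<le> ?C" using k2_ge_1 derivative_pos[OF that] that by simp
    have le: "abs (\<phi>' t - \<phi>' s) \<le> ?C * abs (t - s)" if "0 \<le> s" "s < t" "t \<le> b" for s t
    proof -
      have "k2 * (\<phi>' t / t) * (t - s) \<le> ?C * (t - s)"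
        using that k2_ge_1 quotient_mono[of t b] by (intro mult_right_mono mult_left_mono) auto
      then show ?thesis using derivative_diff_le[OF that(1,2)] derivative_mono[of s t] that by simp
    qed
    have "abs (\<phi>' s - \<phi>' t) \<le> ?C * abs (s - t)" if "0 \<le> s" "0 \<le> t" "s \<le> b" "t \<le> b" for s t
    proof -
      consider "s < t" | "s = t" | "t < s" by linarith
      then show ?thesis
      proof cases
        case 1
        then show ?thesis using le[of s t] that by (simp add: abs_minus_commute)
      next
        case 3
        then show ?thesis using le[of t s] that by simp
      qed simp
    qed
    then show "?C-lipschitz_on {0..b} \<phi>'"
      using C by (intro lipschitz_onI) (auto simp: dist_real_def)
  qed
  show ?thesis
  proof (rule continuous_on_eq_continuous_within[THEN iffD2], rule ballI)
    fix x :: real assume x: "x \<in> {0..}"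
    have "continuous (at x within {0..x + 1}) \<phi>'"
      using cont[of "x + 1"] x by (simp add: continuous_on_eq_continuous_within)
    moreover have "at x within {0..x + 1} = at x within {0..}"
      by (rule at_within_nhd[of _ "{..<x + 1}"]) auto
    ultimately show "continuous (at x within {0..}) \<phi>'" by simp
  qed
qed

lemma integrand_derivative:
  assumes "0 \<le> t" shows "(\<phi> has_real_derivative \<phi>' t) (at t within {0..})"
proof -
  have "((\<lambda>x. integral {0..x} \<phi>') has_real_derivative \<phi>' t) (at t within {0..t + 1})"
    using assms by (intro integral_has_real_derivative continuous_on_subset[OF derivative_continuous]) auto
  moreover have "at t within {0..t + 1} = at t within {0..}"
    by (rule at_within_nhd[of _ "{..<t + 1}"]) auto
  ultimately have "((\<lambda>x. integral {0..x} \<phi>') has_real_derivative \<phi>' t) (at t within {0..})"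
    by simp
  moreover have "integral {0..x} \<phi>' = \<phi> x" if "0 \<le> x" for x
    using N_function that by (auto simp: N_function_def intro: integral_unique)
  ultimately show ?thesis
    using assms by (auto intro: has_field_derivative_transform_within[where d=1])
qed

context
  fixes a b :: real
  assumes ab: "0 < a" "a \<le> b"
begin

definition clamped_quotient :: "real \<Rightarrow> real" where
  "clamped_quotient t = \<phi>' (max a (min t b)) / max a (min t b)"

text \<open>The branches agree in value and slope at \<open>a\<close> and \<open>b\<close>. So the
  derivative is established on three closed pieces that cover the half line and glued as a supremum
  of filters; on a piece that misses \<open>t\<close> the filter is trivial.\<close>

lemma phi_reg_derivative:
  assumes "0 \<le> t"
  shows "(phi_reg \<phi> \<phi>' a b has_real_derivative clamped_quotient t * t) (at t within {0..})"
proof -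
  let ?D = "clamped_quotient t * t"
  have quad: "((\<lambda>x. \<phi>' c / (2 * c) * x\<^sup>2 + \<phi> c - c / 2 * \<phi>' c) has_real_derivative \<phi>' c / c * t) (at t within X)"
    if "0 < c" for c X
    using that by (auto intro!: derivative_eq_intros)
  have left: "(phi_reg \<phi> \<phi>' a b has_real_derivative ?D) (at t within {0..a})"
  proof (cases "t \<le> a")
    case True
    then have "((\<lambda>x. \<phi>' a / (2 * a) * x\<^sup>2 + \<phi> a - a / 2 * \<phi>' a) has_real_derivative ?D) (at t within {0..a})"
      using quad[of a "{0..a}"] ab by (simp add: clamped_quotient_def)
    then show ?thesis
      by (rule has_field_derivative_transform_within[where d=1])
        (use True assms ab in \<open>auto simp: phi_reg_def power2_eq_square field_simps\<close>)
  next
    case False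
    then have "at t within {0..a} = bot" using not_in_closure_trivial_limitI[of t "{0..a}"] assms
      by (simp add: trivial_limit_def)
    then show ?thesis by (simp add: has_field_derivative_iff)
  qed
  have middle: "(phi_reg \<phi> \<phi>' a b has_real_derivative ?D) (at t within {a..b})"
  proof (cases "a \<le> t \<and> t \<le> b")
    case True
    then have "(\<phi> has_real_derivative ?D) (at t within {a..b})"
      using integrand_derivative[OF assms] ab
      by (auto simp: clamped_quotient_def intro: has_field_derivative_subset)
    then show ?thesis
      by (rule has_field_derivative_transform_within[where d=1])
        (use True in \<open>auto simp: phi_reg_def\<close>)
  next
    case False
    then have "at t within {a..b} = bot" using not_in_closure_trivial_limitI[of t "{a..b}"]
      by (auto simp: trivial_limit_def)
    then show ?thesis by (simp add: has_field_derivative_iff)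
  qed
  have right: "(phi_reg \<phi> \<phi>' a b has_real_derivative ?D) (at t within {b..})"
  proof (cases "b \<le> t")
    case True
    then have "((\<lambda>x. \<phi>' b / (2 * b) * x\<^sup>2 + \<phi> b - b / 2 * \<phi>' b) has_real_derivative ?D) (at t within {b..})"
      using quad[of b "{b..}"] ab by (simp add: clamped_quotient_def)
    then show ?thesis
      by (rule has_field_derivative_transform_within[where d=1])
        (use True assms ab in \<open>auto simp: phi_reg_def power2_eq_square field_simps\<close>)
  next
    case False
    then have "at t within {b..} = bot" using not_in_closure_trivial_limitI[of t "{b..}"]
      by (simp add: trivial_limit_def)
    then show ?thesis by (simp add: has_field_derivative_iff)
  qed
  have "{0..} = {0..a} \<union> ({a..b} \<union> {b..})" using ab by auto
  then have "at t within {0..} = sup (at t within {0..a}) (sup (at t within {a..b}) (at t within {b..}))"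
    by (simp only: at_within_union)
  then show ?thesis
    using left middle right unfolding has_field_derivative_iff by (simp only: filterlim_sup)
qed

lemma clamped_quotient_mono: "s \<le> t \<Longrightarrow> clamped_quotient s \<le> clamped_quotient t"
  unfolding clamped_quotient_def using ab by (intro quotient_mono) auto

lemma relaxed_integrand_phi_reg:
  "relaxed_integrand (phi_reg \<phi> \<phi>' a b) clamped_quotient (\<phi>' b / b) k2"
proof
  have q0: "clamped_quotient t = \<phi>' a / a" if "t \<le> a" for t
    using that ab by (simp add: clamped_quotient_def)
  show "0 < clamped_quotient 0" using q0[of 0] ab derivative_pos[of a] by simp
  show "mono_on {0..} clamped_quotient" by (intro mono_onI clamped_quotient_mono)
  show "clamped_quotient t \<le> \<phi>' b / b" for t
    using quotient_mono[of "max a (min t b)" b] ab unfolding clamped_quotient_def by simp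
  have "eventually (\<lambda>t. t < a) (at_right 0)"
    using ab by (auto intro: eventually_at_rightI[of 0 a])
  then have "eventually (\<lambda>t. clamped_quotient t = clamped_quotient 0) (at_right 0)"
    by (rule eventually_mono) (use q0 ab in auto)
  then show "(clamped_quotient \<longlongrightarrow> clamped_quotient 0) (at_right 0)"
    by (rule tendsto_eventually)
  show "1 \<le> k2" by (rule k2_ge_1)
  show "(clamped_quotient t - clamped_quotient s) * s \<le> (k2 - 1) * clamped_quotient t * (t - s)"
    if "0 \<le> s" "s \<le> t" for s t
  proof -
    have pos: "0 < clamped_quotient t"
      unfolding clamped_quotient_def using ab by (intro divide_pos_pos derivative_pos) auto
    have rhs: "0 \<le> (k2 - 1) * clamped_quotient t * (t - s)"
      using pos k2_ge_1 that by simp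
    consider "b \<le> s" | "t \<le> a" | "s < b" "a < t" by linarith
    then show ?thesis
    proof cases
      case 1
      then have "clamped_quotient s = clamped_quotient t" using that ab by (simp add: clamped_quotient_def)
      then show ?thesis using rhs by simp
    next
      case 2
      then have "clamped_quotient s = clamped_quotient t" using that q0 by simp
      then show ?thesis using rhs by simp
    next
      case 3
      \<comment> \<open>Passing to the clamped arguments keeps both weights, enlarges the factor
        \<open>s\<close> on the left and shrinks the gap \<open>t - s\<close> on the right, so the
        bound for \<phi> at \<open>s'\<close> and \<open>t'\<close> suffices.\<close>
      define t' where "t' = max a (min t b)"
      define s' where "s' = max a (min s b)"
      have le: "s \<le> s'" "t' \<le> t" "s' \<le> t'" "0 < s'" using 3 that ab by (auto simp: s'_def t'_def)
      have q: "clamped_quotient t = \<phi>' t' / t'" "clamped_quotient s = \<phi>' s' / s'"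
        by (simp_all add: clamped_quotient_def s'_def t'_def)
      have "(clamped_quotient t - clamped_quotient s) * s \<le> (clamped_quotient t - clamped_quotient s) * s'"
        using clamped_quotient_mono[OF that(2)] le by (intro mult_left_mono) auto
      also have "\<dots> \<le> (k2 - 1) * clamped_quotient t * (t' - s')"
      proof (cases "s' = t'")
        case False
        then have "\<phi>' t' - \<phi>' s' \<le> k2 * clamped_quotient t * (t' - s')"
          using derivative_diff_le[of s' t'] le unfolding q by simp
        moreover have "clamped_quotient t * t' = \<phi>' t'" "clamped_quotient s * s' = \<phi>' s'"
          using le unfolding q by auto
        ultimately show ?thesis by (simp add: algebra_simps)
      qed (simp add: q)
      also have "\<dots> \<le> (k2 - 1) * clamped_quotient t * (t - s)"
        using le pos k2_ge_1 by (intro mult_left_mono) auto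
      finally show ?thesis .
    qed
  qed
qed (rule phi_reg_derivative)

lemma V_fun_phi_reg: "V_fun (phi_reg' \<phi>' a b) x = sqrt (clamped_quotient (abs x)) * x"
  using phi_reg'_eq_clamp[OF ab, of "abs x" \<phi>'] quotient_mono
  by (simp add: V_fun_def clamped_quotient_def)

text \<open>From \<open>a\<close> up to \<open>b\<close> the derivatives agree; below
  \<open>a\<close> both have absolute value at most \<open>\<phi>' a\<close> and the same sign. This
  is the error \<open>q\<close> of \<open>J_gap\<close>.\<close>

lemma clamped_quotient_approx:
  assumes "abs x \<le> b"
  shows "abs (clamped_quotient (abs x) * x - sgn x * \<phi>' (abs x)) \<le> \<phi>' a"
proof -
  let ?t = "abs x"
  have "clamped_quotient ?t * x - sgn x * \<phi>' ?t = sgn x * (clamped_quotient ?t * ?t - \<phi>' ?t)"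
    by (simp add: right_diff_distrib sgn_if abs_if)
  then have eq: "abs (clamped_quotient ?t * x - sgn x * \<phi>' ?t) \<le> abs (clamped_quotient ?t * ?t - \<phi>' ?t)"
    by (simp add: abs_mult sgn_if)
  show ?thesis
  proof (cases "?t \<le> a")
    case True
    have "\<phi>' ?t \<le> \<phi>' a / a * ?t"
      using quotient_mono[of ?t a] True derivative_0 by (cases "?t = 0") (auto simp: field_simps)
    moreover have "\<phi>' a / a * ?t \<le> \<phi>' a / a * a"
      using True ab derivative_pos[of a] by (intro mult_left_mono) auto
    moreover have "0 \<le> \<phi>' ?t" using derivative_mono[of 0 ?t] derivative_0 by simp
    moreover have "clamped_quotient ?t = \<phi>' a / a" using True ab by (simp add: clamped_quotient_def)
    ultimately show ?thesis using eq ab by simp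
  next
    case False
    then have "clamped_quotient ?t * ?t = \<phi>' ?t"
      using assms ab by (simp add: clamped_quotient_def)
    then show ?thesis using eq derivative_pos[of a] ab by simp
  qed
qed

end
end

section \<open>The matrix formulation\<close>

lemma mult_mat_vec_index:
  assumes "A \<in> carrier_mat r n" "v \<in> carrier_vec n" "i < r"
  shows "(A *\<^sub>v v) $ i = (\<Sum>j<n. A $$ (i, j) * v $ j)"
  using assms by (auto simp: scalar_prod_def lessThan_atLeast0)

lemma mult_mat_vec_tendsto:
  fixes A :: "real mat"
  assumes "A \<in> carrier_mat r n" "v \<in> carrier_vec n" "\<And>k. u k \<in> carrier_vec n" "i < r"
    and "\<And>j. j < n \<Longrightarrow> (\<lambda>k. u k $ j) \<longlonglongrightarrow> v $ j"
  shows "(\<lambda>k. (A *\<^sub>v u k) $ i) \<longlonglongrightarrow> (A *\<^sub>v v) $ i"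
  unfolding mult_mat_vec_index[OF assms(1,2,4)] mult_mat_vec_index[OF assms(1,3,4)]
  by (intro tendsto_intros assms(5)) simp

lemma scalar_prod_self_eq_0:
  fixes v :: "real vec"
  assumes "v \<in> carrier_vec n"
  shows "0 \<le> v \<bullet> v" and "v \<bullet> v = 0 \<Longrightarrow> v = 0\<^sub>v n"
proof -
  have eq: "v \<bullet> v = (\<Sum>i\<in>{0..<n}. (v $ i)\<^sup>2)"
    using assms by (simp add: scalar_prod_def power2_eq_square)
  show "0 \<le> v \<bullet> v" unfolding eq by (intro sum_nonneg) simp
  assume "v \<bullet> v = 0"
  then have "\<forall>i\<in>{0..<n}. (v $ i)\<^sup>2 = 0" unfolding eq by (subst (asm) sum_nonneg_eq_0_iff) auto
  then show "v = 0\<^sub>v n" using assms by (intro eq_vecI) auto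
qed

text \<open>The quadratic form of \<open>A\<close> is the sum of the squared norms of
  \<open>B v\<close> and \<open>C v\<close>, which vanishes only on the common kernel, so
  \<open>A\<close> is invertible. On the kernel of \<open>C\<close> it acts as the Gram matrix of
  \<open>B\<close>.\<close>

lemma trivial_kernel_left_inverse:
  fixes B C :: "real mat"
  assumes B: "B \<in> carrier_mat M N" and C: "C \<in> carrier_mat mc N"
    and ker: "mat_kernel B \<inter> mat_kernel C = {0\<^sub>v N}"
  obtains P where "P \<in> carrier_mat N M" "\<And>v. v \<in> mat_kernel C \<Longrightarrow> P *\<^sub>v (B *\<^sub>v v) = v"
proof -
  define A where "A = transpose_mat B * B + transpose_mat C * C"
  have A: "A \<in> carrier_mat N N" using B C by (auto simp: A_def)
  have Av: "A *\<^sub>v v = transpose_mat B *\<^sub>v (B *\<^sub>v v) + transpose_mat C *\<^sub>v (C *\<^sub>v v)"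
    if "v \<in> carrier_vec N" for v
    using B C that unfolding A_def
    by (subst add_mult_distrib_mat_vec[of _ N N]) (auto simp: assoc_mult_mat_vec[of _ N _ _ N])
  have "v = 0\<^sub>v N" if v: "v \<in> carrier_vec N" and "A *\<^sub>v v = 0\<^sub>v N" for v
  proof -
    have Bv: "B *\<^sub>v v \<in> carrier_vec M" and Cv: "C *\<^sub>v v \<in> carrier_vec mc" using B C v by auto
    have "0 = (A *\<^sub>v v) \<bullet> v" using that by simp
    also have "\<dots> = (transpose_mat B *\<^sub>v (B *\<^sub>v v)) \<bullet> v + (transpose_mat C *\<^sub>v (C *\<^sub>v v)) \<bullet> v"
      unfolding Av[OF v] using B C v by (intro add_scalar_prod_distrib[of _ N]) auto
    also have "\<dots> = (B *\<^sub>v v) \<bullet> (B *\<^sub>v v) + (C *\<^sub>v v) \<bullet> (C *\<^sub>v v)"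
      using transpose_vec_mult_scalar[OF B v Bv] transpose_vec_mult_scalar[OF C v Cv] by simp
    finally have "(B *\<^sub>v v) \<bullet> (B *\<^sub>v v) = 0" "(C *\<^sub>v v) \<bullet> (C *\<^sub>v v) = 0"
      using scalar_prod_self_eq_0(1)[OF Bv] scalar_prod_self_eq_0(1)[OF Cv] by linarith+
    then have "B *\<^sub>v v = 0\<^sub>v M" "C *\<^sub>v v = 0\<^sub>v mc"
      using scalar_prod_self_eq_0(2)[OF Bv] scalar_prod_self_eq_0(2)[OF Cv] by auto
    then have "v \<in> mat_kernel B \<inter> mat_kernel C" using B C v by (auto simp: mat_kernel_def)
    then show ?thesis using ker by simp
  qed
  then have "det A \<noteq> 0" using det_0_iff_vec_prod_zero_field[OF A] by auto
  then obtain Q where Q: "Q \<in> carrier_mat N N" "Q * A = 1\<^sub>m N"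
    using det_non_zero_imp_unit[OF A, of undefined] by (auto simp: Units_def ring_mat_def)
  show ?thesis
  proof
    show "Q * transpose_mat B \<in> carrier_mat N M" using Q B by simp
    fix v assume "v \<in> mat_kernel C"
    then have v: "v \<in> carrier_vec N" and Cv: "C *\<^sub>v v = 0\<^sub>v mc" using C by (auto simp: mat_kernel_def)
    have Bv: "B *\<^sub>v v \<in> carrier_vec M" using B v by auto
    have "(Q * transpose_mat B) *\<^sub>v (B *\<^sub>v v) = Q *\<^sub>v (transpose_mat B *\<^sub>v (B *\<^sub>v v))"
      using Q B Bv by (intro assoc_mult_mat_vec[of _ N N _ M]) auto
    also have "transpose_mat B *\<^sub>v (B *\<^sub>v v) = A *\<^sub>v v"
    proof -
      have "transpose_mat C *\<^sub>v 0\<^sub>v mc = 0\<^sub>v N" using C by auto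
      then show ?thesis unfolding Av[OF v] Cv using B Bv by simp
    qed
    also have "Q *\<^sub>v (A *\<^sub>v v) = (Q * A) *\<^sub>v v" using assoc_mult_mat_vec[OF Q(1) A v] by simp
    finally show "(Q * transpose_mat B) *\<^sub>v (B *\<^sub>v v) = v" using Q v by simp
  qed
qed

text \<open>Applying \<open>P\<close> to the convergent images recovers the vectors
  \<open>v n\<close>, so these converge too, and the kernel condition and the image pass to the
  limit by continuity.\<close>

lemma sequentially_closed_kernel_image:
  fixes B C :: "real mat"
  assumes B: "B \<in> carrier_mat M N" and C: "C \<in> carrier_mat mc N"
    and P: "P \<in> carrier_mat N M" "\<And>v. v \<in> mat_kernel C \<Longrightarrow> P *\<^sub>v (B *\<^sub>v v) = v"
    and v: "\<And>n. v n \<in> mat_kernel C"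
    and lim: "\<And>i. i < M \<Longrightarrow> (\<lambda>n. (B *\<^sub>v v n) $ i) \<longlonglongrightarrow> y i"
  shows "\<exists>u\<in>mat_kernel C. \<forall>i<M. y i = (B *\<^sub>v u) $ i"
proof -
  define u where "u = P *\<^sub>v vec M y"
  have u: "u \<in> carrier_vec N" and vN: "\<And>n. v n \<in> carrier_vec N"
    using P v C by (auto simp: u_def mat_kernel_def)
  have "(\<lambda>n. (P *\<^sub>v (B *\<^sub>v v n)) $ j) \<longlonglongrightarrow> u $ j" if "j < N" for j
    unfolding u_def using B vN lim that by (intro mult_mat_vec_tendsto[OF P(1)]) auto
  then have lim_v: "(\<lambda>n. v n $ j) \<longlonglongrightarrow> u $ j" if "j < N" for j
    using that P(2)[OF v] by simp
  have "(C *\<^sub>v u) $ r = 0" if "r < mc" for r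
  proof -
    have "(\<lambda>n. (C *\<^sub>v v n) $ r) \<longlonglongrightarrow> (C *\<^sub>v u) $ r"
      by (rule mult_mat_vec_tendsto[OF C u vN that lim_v])
    moreover have "(C *\<^sub>v v n) $ r = 0" for n using v[of n] C that by (simp add: mat_kernel_def)
    ultimately show ?thesis by (simp add: LIMSEQ_const_iff)
  qed
  then have "u \<in> mat_kernel C" using C u by (auto simp: mat_kernel_def intro!: eq_vecI)
  moreover have "y i = (B *\<^sub>v u) $ i" if "i < M" for i
    using LIMSEQ_unique[OF lim[OF that] mult_mat_vec_tendsto[OF B u vN that lim_v]] .
  ultimately show ?thesis by blast
qed

lemma mat_kernel_lincomb:
  fixes C :: "real mat"
  assumes C: "C \<in> carrier_mat mc N" and "u \<in> mat_kernel C" "v \<in> mat_kernel C"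
  shows "a \<cdot>\<^sub>v u + b \<cdot>\<^sub>v v \<in> mat_kernel C"
proof -
  have u: "u \<in> carrier_vec N" "C *\<^sub>v u = 0\<^sub>v mc" and v: "v \<in> carrier_vec N" "C *\<^sub>v v = 0\<^sub>v mc"
    using assms by (auto simp: mat_kernel_def)
  have "C *\<^sub>v (a \<cdot>\<^sub>v u + b \<cdot>\<^sub>v v) = 0\<^sub>v mc"
    using C u v by (simp add: mult_add_distrib_mat_vec[OF C] mult_mat_vec) auto
  then show ?thesis using C u v by (auto simp: mat_kernel_def)
qed

lemma mult_mat_vec_lincomb:
  fixes B :: "real mat"
  assumes B: "B \<in> carrier_mat M N" and "u \<in> carrier_vec N" "v \<in> carrier_vec N" "i < M"
  shows "(B *\<^sub>v (a \<cdot>\<^sub>v u + b \<cdot>\<^sub>v v)) $ i = a * (B *\<^sub>v u) $ i + b * (B *\<^sub>v v) $ i"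
  using assms by (simp add: mult_add_distrib_mat_vec[OF B] mult_mat_vec del: index_mult_mat_vec)

section \<open>Choice of the interval and transfer to matrices\<close>

lemma (in uniformly_convex_N_function) regularized_dirls_estimate:
  fixes B C :: "real mat" and w :: "nat \<Rightarrow> real" and f g u :: "real vec" and \<epsilon> :: real
  assumes B: "B \<in> carrier_mat M N" and C: "C \<in> carrier_mat mc N"
    and w: "\<And>i. i < M \<Longrightarrow> 0 < w i" and f: "f \<in> carrier_vec N" and g: "g \<in> carrier_vec N"
    and ker: "mat_kernel B \<inter> mat_kernel C = {0\<^sub>v N}"
    and u_min: "is_arg_min (\<lambda>v. primal_energy B w f \<phi> (v + g)) (\<lambda>v. v \<in> mat_kernel C) u"
    and "0 < \<epsilon>"
  shows "\<exists>a b u\<^sub>\<delta> \<sigma>\<^sub>\<delta> \<kappa> C\<^sub>\<delta>. 0 < a \<and> a \<le> b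
    \<and> is_arg_min (\<lambda>v. primal_energy B w f (phi_reg \<phi> \<phi>' a b) (v + g)) (\<lambda>v. v \<in> mat_kernel C) u\<^sub>\<delta>
    \<and> primal_energy B w f (phi_reg \<phi> \<phi>' a b) (u + g) - primal_energy B w f (phi_reg \<phi> \<phi>' a b) (u\<^sub>\<delta> + g) \<le> \<epsilon>
    \<and> 0 < \<kappa> \<and> \<kappa> < 1
    \<and> is_arg_min (dual_energy B w g (phi_reg \<phi> \<phi>' a b)) (\<lambda>\<tau>. \<tau> \<in> dual_feasible B C f) \<sigma>\<^sub>\<delta>
    \<and> (\<forall>\<sigma> u_it n. \<sigma> 0 \<in> dual_feasible B C f \<longrightarrow> dirls_iterates B C w f g (phi_reg \<phi> \<phi>' a b) \<sigma> u_it \<longrightarrow> 1 \<le> n \<longrightarrow>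
        (\<Sum>i<M. w i * (V_fun (phi_reg' \<phi>' a b) ((B *\<^sub>v (u + g)) $ i)
            - V_fun (phi_reg' \<phi>' a b) ((B *\<^sub>v (u_it n + g)) $ i))\<^sup>2)
        \<le> 32 * k2 ^ 3 * (\<epsilon> + C\<^sub>\<delta> * (1 - \<kappa>) ^ n
            * (dual_energy B w g (phi_reg \<phi> \<phi>' a b) (\<sigma> 0) - dual_energy B w g (phi_reg \<phi> \<phi>' a b) \<sigma>\<^sub>\<delta>)))"
proof -
  have dimB: "dim_row B = M" "dim_col B = N" using B by auto
  have V0: "v \<in> carrier_vec N" if "v \<in> mat_kernel C" for v using that C by (simp add: mat_kernel_def)
  have u: "u \<in> mat_kernel C" using u_min by (simp add: is_arg_min_def)
  define y0 where "y0 = (\<lambda>i. (B *\<^sub>v g) $ i)"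
  define X where "X = (\<lambda>v i. (B *\<^sub>v v) $ i)"
  define S where "S = {y. \<exists>v\<in>mat_kernel C. \<forall>i<M. y i = X v i}"
  have X_S: "X v \<in> S" if "v \<in> mat_kernel C" for v using that by (auto simp: S_def)
  have X_lincomb: "X (c \<cdot>\<^sub>v v + d \<cdot>\<^sub>v v') i = c * X v i + d * X v' i"
    if "v \<in> mat_kernel C" "v' \<in> mat_kernel C" "i < M" for c d v v' i
    unfolding X_def using mult_mat_vec_lincomb[OF B V0 V0] that by blast
  have B_add: "(B *\<^sub>v (v + g)) $ i = y0 i + X v i" if "v \<in> mat_kernel C" "i < M" for v i
    using mult_add_distrib_mat_vec[OF B V0[OF that(1)] g] that(2) dimB
    unfolding y0_def X_def by (simp add: add.commute del: index_mult_mat_vec)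
  obtain P where P: "P \<in> carrier_mat N M" "\<And>v. v \<in> mat_kernel C \<Longrightarrow> P *\<^sub>v (B *\<^sub>v v) = v"
    using trivial_kernel_left_inverse[OF B C ker] by blast
  \<comment> \<open>on \<open>V\<^sub>0\<close> the load \<open>f \<bullet> v\<close> depends on \<open>v\<close> only through \<open>B v\<close>\<close>
  define h where "h = (\<lambda>i. (transpose_mat P *\<^sub>v f) $ i)"
  have fv: "f \<bullet> v = (\<Sum>i<M. h i * X v i)" if "v \<in> mat_kernel C" for v
  proof -
    have Bv: "B *\<^sub>v v \<in> carrier_vec M" using B V0[OF that] by auto
    have "f \<bullet> v = f \<bullet> (P *\<^sub>v (B *\<^sub>v v))" using P that by simp
    also have "\<dots> = (transpose_mat P *\<^sub>v f) \<bullet> (B *\<^sub>v v)"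
      using transpose_vec_mult_scalar[OF P(1) Bv f] by simp
    also have "\<dots> = (\<Sum>i<M. h i * X v i)"
      using dimB by (simp add: scalar_prod_def h_def X_def lessThan_atLeast0 del: index_mult_mat_vec)
    finally show ?thesis .
  qed
  have primal: "primal_energy B w f \<theta> (v + g)
      = (\<Sum>i<M. w i * \<theta> (abs (y0 i + X v i))) - (\<Sum>i<M. h i * X v i) - f \<bullet> g"
    if "v \<in> mat_kernel C" for \<theta> v
    using B_add[OF that] fv[OF that] scalar_prod_add_distrib[OF f V0[OF that] g] dimB
    by (simp add: primal_energy_def del: index_mult_mat_vec)
  have u_critical: "(\<Sum>i<M. w i * (sgn (y0 i + X u i) * \<phi>' (abs (y0 i + X u i))) * X v i) = (\<Sum>i<M. h i * X v i)"
    if v: "v \<in> mat_kernel C" for v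
  proof (rule euler_lagrange[OF integrand_derivative derivative_0])
    fix t
    have v': "1 \<cdot>\<^sub>v u + t \<cdot>\<^sub>v v \<in> mat_kernel C" using mat_kernel_lincomb[OF C u v] .
    have "primal_energy B w f \<phi> (u + g) \<le> primal_energy B w f \<phi> (1 \<cdot>\<^sub>v u + t \<cdot>\<^sub>v v + g)"
      using u_min v' by (auto simp: is_arg_min_def not_less)
    then show "(\<Sum>i<M. w i * \<phi> (abs (y0 i + X u i)))
        \<le> (\<Sum>i<M. w i * \<phi> (abs (y0 i + X u i + t * X v i))) - t * (\<Sum>i<M. h i * X v i)"
      unfolding primal[OF u] primal[OF v'] using X_lincomb[OF u v, of _ 1 t]
      by (simp add: distrib_left sum.distrib sum_distrib_left add.assoc mult.left_commute)
  qed

  define W where "W = (\<Sum>i<M. w i)"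
  have W: "0 \<le> W" unfolding W_def using w by (intro sum_nonneg) (auto intro: less_imp_le)
  \<comment> \<open>The gap bound from \<open>J_gap\<close> is \<open>W * a * \<phi>' a / 2\<close>.
    Since \<open>a \<le> 1\<close>, it is at most \<open>a * (W * \<phi>' 1)\<close>, hence at most
    \<epsilon>; the summand 1 keeps the denominator positive.\<close>
  define a where "a = min 1 (\<epsilon> / (1 + W * \<phi>' 1))"
  \<comment> \<open>The sum dominates each entry of \<open>B (u + g)\<close>, and the summand 1
    ensures \<open>a \<le> b\<close>.\<close>
  define b where "b = 1 + (\<Sum>i<M. abs (y0 i + X u i))"
  have p1: "0 < 1 + W * \<phi>' 1" using W derivative_pos[of 1] by (intro add_pos_nonneg) auto
  have a: "0 < a" "a \<le> 1" "a * (1 + W * \<phi>' 1) \<le> \<epsilon>"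
    using \<open>0 < \<epsilon>\<close> p1 by (simp_all add: a_def flip: pos_le_divide_eq)
  have "0 \<le> (\<Sum>i<M. abs (y0 i + X u i))" by (intro sum_nonneg) simp
  then have ab: "a \<le> b" using a(2) unfolding b_def by linarith
  have b: "abs (y0 i + X u i) \<le> b" if "i < M" for i
    using member_le_sum[of i "{..<M}" "\<lambda>i. abs (y0 i + X u i)"] that by (simp add: b_def)

  let ?\<psi> = "phi_reg \<phi> \<phi>' a b"
  let ?\<mu> = "clamped_quotient a b"
  interpret dirls_problem ?\<psi> ?\<mu> "\<phi>' b / b" k2 M w y0 h S
  proof (intro dirls_problem.intro relaxed_integrand_phi_reg[OF a(1) ab] dirls_problem_axioms.intro)
    show "0 < w i" if "i < M" for i using w that .
    show "(\<lambda>_. 0) \<in> S"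
    proof -
      have "0\<^sub>v N \<in> mat_kernel C" using ker by blast
      moreover have "X (0\<^sub>v N) i = 0" if "i < M" for i
        using B that unfolding X_def by simp
      ultimately show ?thesis by (auto simp: S_def intro!: bexI[of _ "0\<^sub>v N"])
    qed
    show "(\<lambda>i. c * x i + d * y i) \<in> S" if xS: "x \<in> S" and yS: "y \<in> S" for x y c d
    proof -
      obtain v v' where v: "v \<in> mat_kernel C" "v' \<in> mat_kernel C"
        and xy: "\<And>i. i < M \<Longrightarrow> x i = X v i" "\<And>i. i < M \<Longrightarrow> y i = X v' i"
        using xS yS by (auto simp: S_def)
      have "c \<cdot>\<^sub>v v + d \<cdot>\<^sub>v v' \<in> mat_kernel C" using mat_kernel_lincomb[OF C v] .
      moreover have "c * x i + d * y i = X (c \<cdot>\<^sub>v v + d \<cdot>\<^sub>v v') i" if "i < M" for i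
        using X_lincomb[OF v that] xy that by simp
      ultimately show ?thesis unfolding S_def by blast
    qed
    show "y \<in> S" if Y: "\<And>n. Y n \<in> S" and lim: "\<And>i. i < M \<Longrightarrow> (\<lambda>n. Y n i) \<longlonglongrightarrow> y i" for Y y
    proof -
      obtain v where v: "\<And>n. v n \<in> mat_kernel C" "\<And>n i. i < M \<Longrightarrow> Y n i = X (v n) i"
        using Y unfolding S_def by (simp, metis)
      show ?thesis
        using sequentially_closed_kernel_image[where v=v and y=y, OF B C P v(1)] lim v(2)
        unfolding S_def X_def by simp
    qed
  qed

  have J_eq: "primal_energy B w f ?\<psi> (v + g) = J (X v) - f \<bullet> g" if "v \<in> mat_kernel C" for v
    unfolding primal[OF that] J_def ..
  have m_eq: "?\<mu> 0 = \<phi>' a / a" using a ab by (simp add: clamped_quotient_def[OF a(1) ab])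
  have gap: "J (X u) - \<epsilon> \<le> J z" if "z \<in> S" for z
  proof -
    have "J (X u) - (\<phi>' a)\<^sup>2 / (2 * ?\<mu> 0) * (\<Sum>i<M. w i) \<le> J z"
    proof (rule J_gap[OF X_S[OF u] that, where d="\<lambda>i. sgn (y0 i + X u i) * \<phi>' (abs (y0 i + X u i))"])
      show "abs (?\<mu> (abs (y0 i + X u i)) * (y0 i + X u i) - sgn (y0 i + X u i) * \<phi>' (abs (y0 i + X u i))) \<le> \<phi>' a"
        if "i < M" for i using clamped_quotient_approx[OF a(1) ab b[OF that]] .
      fix x assume "x \<in> S"
      then obtain v where v: "v \<in> mat_kernel C" "\<And>i. i < M \<Longrightarrow> x i = X v i" by (auto simp: S_def)
      then show "(\<Sum>i<M. w i * (sgn (y0 i + X u i) * \<phi>' (abs (y0 i + X u i))) * x i) = (\<Sum>i<M. h i * x i)"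
        using u_critical[OF v(1)] by simp
    qed
    moreover have "(\<phi>' a)\<^sup>2 / (2 * ?\<mu> 0) * (\<Sum>i<M. w i) \<le> \<epsilon>"
    proof -
      have "(\<phi>' a)\<^sup>2 / (2 * ?\<mu> 0) = a * \<phi>' a / 2"
        using derivative_pos[OF a(1)] unfolding m_eq by (simp add: power2_eq_square)
      also have "\<dots> \<le> a * \<phi>' 1"
        using a derivative_mono[of a 1] derivative_pos[OF a(1)] by (simp add: mult_left_mono)
      finally have "(\<phi>' a)\<^sup>2 / (2 * ?\<mu> 0) * W \<le> a * \<phi>' 1 * W" using W by (rule mult_right_mono)
      also have "\<dots> \<le> \<epsilon>" using a by (simp add: algebra_simps)
      finally show ?thesis by (simp add: W_def)
    qed
    ultimately show ?thesis by linarith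
  qed
  obtain z where z: "z \<in> S" "\<And>x. x \<in> S \<Longrightarrow> J z \<le> J x" using ex_minimizer[OF gap] by blast
  obtain u\<^sub>\<delta> where u\<delta>: "u\<^sub>\<delta> \<in> mat_kernel C" and zu: "\<And>i. i < M \<Longrightarrow> z i = X u\<^sub>\<delta> i"
    using z(1) by (auto simp: S_def)
  have Jz: "J z = J (X u\<^sub>\<delta>)" using zu by (simp add: J_def)
  have critical: "dJ z x = 0" if "x \<in> S" for x using minimizer_critical[OF z that] .

  define \<sigma>\<^sub>\<delta> where "\<sigma>\<^sub>\<delta> = vec M (flux z)"
  have dual: "dual_energy B w g ?\<psi> \<tau> = Jd (\<lambda>i. \<tau> $ i)" for \<tau>
  proof -
    have "\<tau> \<bullet> (B *\<^sub>v g) = (\<Sum>i<M. \<tau> $ i * y0 i)"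
      using dimB by (simp add: scalar_prod_def y0_def lessThan_atLeast0 del: index_mult_mat_vec)
    moreover have "inverse (w i) * abs (\<tau> $ i) = abs (\<tau> $ i / w i)" if "i < M" for i
      using w[OF that] by (simp add: field_simps)
    ultimately show ?thesis using dimB by (simp add: dual_energy_def Jd_def)
  qed
  have feasible_iff: "\<tau> \<in> dual_feasible B C f \<longleftrightarrow> \<tau> \<in> carrier_vec M \<and> feasible (\<lambda>i. \<tau> $ i)" for \<tau>
  proof -
    have "\<tau> \<bullet> (B *\<^sub>v v) = (\<Sum>i<M. \<tau> $ i * X v i)" for v
      using dimB by (simp add: scalar_prod_def X_def lessThan_atLeast0 del: index_mult_mat_vec)
    then have "\<tau> \<in> dual_feasible B C f \<longleftrightarrow> \<tau> \<in> carrier_vec M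
        \<and> (\<forall>v\<in>mat_kernel C. (\<Sum>i<M. \<tau> $ i * X v i) = (\<Sum>i<M. h i * X v i))"
      using dimB fv by (simp add: dual_feasible_def)
    moreover have "(\<forall>v\<in>mat_kernel C. (\<Sum>i<M. \<tau> $ i * X v i) = (\<Sum>i<M. h i * X v i)) \<longleftrightarrow> feasible (\<lambda>i. \<tau> $ i)"
      unfolding feasible_def using X_S by (auto simp: S_def)
    ultimately show ?thesis by blast
  qed
  have Jd_\<sigma>\<delta>: "Jd (\<lambda>i. \<sigma>\<^sub>\<delta> $ i) = Jd (flux z)" by (simp add: Jd_def \<sigma>\<^sub>\<delta>_def)
  have "feasible (\<lambda>i. \<sigma>\<^sub>\<delta> $ i)" using flux_feasible[OF critical] by (simp add: feasible_def \<sigma>\<^sub>\<delta>_def)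
  then have \<sigma>\<delta>_min: "is_arg_min (dual_energy B w g ?\<psi>) (\<lambda>\<tau>. \<tau> \<in> dual_feasible B C f) \<sigma>\<^sub>\<delta>"
    using flux_minimal[OF z(1) critical]
    by (auto simp: is_arg_min_def feasible_iff dual Jd_\<sigma>\<delta> not_less) (simp add: \<sigma>\<^sub>\<delta>_def)
  have u\<delta>_min: "is_arg_min (\<lambda>v. primal_energy B w f ?\<psi> (v + g)) (\<lambda>v. v \<in> mat_kernel C) u\<^sub>\<delta>"
    using u\<delta> z(2)[OF X_S] by (simp add: is_arg_min_def J_eq not_less flip: Jz)
  have gap_u: "primal_energy B w f ?\<psi> (u + g) - primal_energy B w f ?\<psi> (u\<^sub>\<delta> + g) \<le> \<epsilon>"
    using gap[OF z(1)] by (simp add: J_eq u u\<delta> flip: Jz)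

  define C\<^sub>\<delta> where "C\<^sub>\<delta> = 9 * (k2 * (\<phi>' b / b))\<^sup>2 / (?\<mu> 0)\<^sup>2 / (1 - rate)"
  have estimate: "(\<Sum>i<M. w i * (V_fun (phi_reg' \<phi>' a b) ((B *\<^sub>v (u + g)) $ i)
            - V_fun (phi_reg' \<phi>' a b) ((B *\<^sub>v (u_it n + g)) $ i))\<^sup>2)
      \<le> 32 * k2 ^ 3 * (\<epsilon> + C\<^sub>\<delta> * (1 - rate) ^ n
            * (dual_energy B w g ?\<psi> (\<sigma> 0) - dual_energy B w g ?\<psi> \<sigma>\<^sub>\<delta>))"
    if \<sigma>0: "\<sigma> 0 \<in> dual_feasible B C f" and it: "dirls_iterates B C w f g ?\<psi> \<sigma> u_it" and n: "1 \<le> n"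
    for \<sigma> u_it n
  proof -
    have it: "u_it (Suc k) \<in> mat_kernel C"
      "\<And>v. v \<in> mat_kernel C \<Longrightarrow>
        (\<Sum>i<M. dirls_weight ?\<psi> (w i) (\<sigma> k $ i) * (B *\<^sub>v (u_it (Suc k) + g)) $ i * (B *\<^sub>v v) $ i) = f \<bullet> v"
      "\<sigma> (Suc k) = vec M (\<lambda>i. dirls_weight ?\<psi> (w i) (\<sigma> k $ i) * (B *\<^sub>v (u_it (Suc k) + g)) $ i)" for k
      using it dimB unfolding dirls_iterates_def Let_def by blast+
    have step: "\<sigma> (Suc k) $ i = irls_weight (\<lambda>i. \<sigma> k $ i) i * (y0 i + X (u_it (Suc k)) i)" if "i < M" for k i
      using that dirls_weight_eq[OF w[OF that]] B_add[OF it(1) that]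
      unfolding it(3) by (simp add: irls_weight_def del: index_mult_mat_vec)
    \<comment> \<open>Later iterates are feasible because the linear equation of the scheme is the
      feasibility condition for the new dual variable.\<close>
    have feas: "feasible (\<lambda>i. \<sigma> k $ i)" for k
    proof (cases k)
      case 0
      then show ?thesis using \<sigma>0 feasible_iff by simp
    next
      case (Suc j)
      have "(\<Sum>i<M. \<sigma> (Suc j) $ i * x i) = (\<Sum>i<M. h i * x i)" if xS: "x \<in> S" for x
      proof -
        obtain v where v: "v \<in> mat_kernel C" "\<And>i. i < M \<Longrightarrow> x i = X v i" using xS by (auto simp: S_def)
        have "(\<Sum>i<M. \<sigma> (Suc j) $ i * X v i) = f \<bullet> v"
          unfolding it(3) using it(2)[OF v(1), of j] by (simp add: X_def del: index_mult_mat_vec)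
        then show ?thesis using v fv by simp
      qed
      then show ?thesis by (simp add: feasible_def Suc)
    qed
    have V_eq: "V_fun (phi_reg' \<phi>' a b) x = V x" for x
      unfolding V_fun_phi_reg[OF a(1) ab] V_def ..
    \<comment> \<open>The scheme leaves \<open>u_it 0\<close> arbitrary; writing \<open>n\<close> as
      a successor places \<open>u_it n\<close> in the kernel of \<open>C\<close>.\<close>
    obtain k where k: "n = Suc k" using n by (cases n) auto
    have "(\<Sum>i<M. w i * (V_fun (phi_reg' \<phi>' a b) ((B *\<^sub>v (u + g)) $ i)
            - V_fun (phi_reg' \<phi>' a b) ((B *\<^sub>v (u_it n + g)) $ i))\<^sup>2)
      = (\<Sum>i<M. w i * (V (y0 i + X u i) - V (y0 i + X (u_it n) i))\<^sup>2)"
      unfolding V_eq k using B_add[OF u] B_add[OF it(1)[of k]] by (intro sum.cong) (simp_all del: index_mult_mat_vec)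
    also have "\<dots> \<le> 32 * k2 ^ 3 * (\<epsilon> + C\<^sub>\<delta> * (1 - rate) ^ n * (Jd (\<lambda>i. \<sigma> 0 $ i) - Jd (flux z)))"
      unfolding C\<^sub>\<delta>_def
    proof (rule irls_convergence[OF z(1) critical, where x="\<lambda>k. X (u_it k)" and \<sigma>="\<lambda>k i. \<sigma> k $ i"])
      show "X (u_it (Suc k)) \<in> S" for k by (rule X_S[OF it(1)])
      show "J (X u) - J z \<le> \<epsilon>" using gap[OF z(1)] by simp
    qed (use n feas step X_S[OF u] in auto)
    finally show ?thesis by (simp add: dual Jd_\<sigma>\<delta>)
  qed
  show ?thesis
    by (intro exI[of _ a] exI[of _ b] exI[of _ u\<^sub>\<delta>] exI[of _ \<sigma>\<^sub>\<delta>] exI[of _ rate] exI[of _ C\<^sub>\<delta>] conjI allI impI)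
      (fact a(1) ab u\<delta>_min gap_u rate_bounds \<sigma>\<delta>_min estimate)+
qed

theorem mainTheorem2:
  fixes k1 k2 :: real
  assumes "0 < k1" and "k1 \<le> k2"
  shows "\<exists>c::real. \<forall>(M::nat) (N::nat) (mc::nat) (B::real mat) (C::real mat) (d::real vec)
      (w::nat \<Rightarrow> real) (f::real vec) (g::real vec) (\<phi>::real \<Rightarrow> real) (\<phi>'::real \<Rightarrow> real) (u::real vec).
    0 < M \<and> 0 < N \<and> B \<in> carrier_mat M N \<and> C \<in> carrier_mat mc N \<and> d \<in> carrier_vec mc \<and>
    (\<forall>\<alpha><M. 0 < w \<alpha>) \<and> f \<in> carrier_vec N \<and> g \<in> carrier_vec N \<and> C *\<^sub>v g = d \<and>
    mat_kernel B \<inter> mat_kernel C = {0\<^sub>v N} \<and>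
    N_function \<phi> \<phi>' \<and> uniformly_convex_fun k1 k2 \<phi>' \<and>
    (\<forall>t T. 0 < t \<and> t \<le> T \<longrightarrow> \<phi>' t / t \<le> \<phi>' T / T) \<and>
    is_arg_min (\<lambda>v. primal_energy B w f \<phi> (v + g)) (\<lambda>v. v \<in> mat_kernel C) u
    \<longrightarrow>
    (\<forall>\<epsilon>>0. \<exists>(a::real) (b::real) u\<^sub>\<delta>.
      let \<phi>\<^sub>\<delta> = phi_reg \<phi> \<phi>' a b;
          V = V_fun (phi_reg' \<phi>' a b);
          J\<^sub>\<delta> = primal_energy B w f \<phi>\<^sub>\<delta>;
          Jd\<^sub>\<delta> = dual_energy B w g \<phi>\<^sub>\<delta>
      in
        0 < a \<and> a \<le> b \<and>
        is_arg_min (\<lambda>v. J\<^sub>\<delta> (v + g)) (\<lambda>v. v \<in> mat_kernel C) u\<^sub>\<delta> \<and>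
        J\<^sub>\<delta> (u + g) - J\<^sub>\<delta> (u\<^sub>\<delta> + g) \<le> \<epsilon> \<and>
        (\<exists>(\<kappa>::real) (C\<^sub>\<delta>::real) \<sigma>\<^sub>\<delta>.
          0 < \<kappa> \<and> \<kappa> < 1 \<and>
          is_arg_min Jd\<^sub>\<delta> (\<lambda>\<tau>. \<tau> \<in> dual_feasible B C f) \<sigma>\<^sub>\<delta> \<and>
          (\<forall>\<sigma> u_it. \<sigma> 0 \<in> dual_feasible B C f \<and> dirls_iterates B C w f g \<phi>\<^sub>\<delta> \<sigma> u_it \<longrightarrow>
            (\<forall>n\<ge>1.
              (\<Sum>\<alpha><M. w \<alpha> *
                \<bar>V ((B *\<^sub>v (u + g)) $ \<alpha>) - V ((B *\<^sub>v (u_it n + g)) $ \<alpha>)\<bar>\<^sup>2)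
              \<le> c * (\<epsilon> + C\<^sub>\<delta> * (1 - \<kappa>) ^ n * (Jd\<^sub>\<delta> (\<sigma> 0) - Jd\<^sub>\<delta> \<sigma>\<^sub>\<delta>))))))"
proof (rule exI[of _ "32 * k2 ^ 3"], intro allI impI, elim conjE)
  fix M N mc :: nat and B C :: "real mat" and d f g u :: "real vec" and w :: "nat \<Rightarrow> real"
    and \<phi> \<phi>' :: "real \<Rightarrow> real" and \<epsilon> :: real
  assume hyps: "B \<in> carrier_mat M N" "C \<in> carrier_mat mc N"
    "\<forall>\<alpha><M. 0 < w \<alpha>" "f \<in> carrier_vec N" "g \<in> carrier_vec N"
    "mat_kernel B \<inter> mat_kernel C = {0\<^sub>v N}"
    "is_arg_min (\<lambda>v. primal_energy B w f \<phi> (v + g)) (\<lambda>v. v \<in> mat_kernel C) u" "0 < \<epsilon>"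
    and \<phi>: "N_function \<phi> \<phi>'" "uniformly_convex_fun k1 k2 \<phi>'"
      "\<forall>t T. 0 < t \<and> t \<le> T \<longrightarrow> \<phi>' t / t \<le> \<phi>' T / T"
  interpret uniformly_convex_N_function \<phi> \<phi>' k1 k2
    by unfold_locales (use \<phi> in auto)
  have w: "\<And>i. i < M \<Longrightarrow> 0 < w i" using hyps(3) by blast
  obtain a b u\<^sub>\<delta> \<sigma>\<^sub>\<delta> \<kappa> C\<^sub>\<delta> where *: "0 < a" "a \<le> b"
    "is_arg_min (\<lambda>v. primal_energy B w f (phi_reg \<phi> \<phi>' a b) (v + g)) (\<lambda>v. v \<in> mat_kernel C) u\<^sub>\<delta>"
    "primal_energy B w f (phi_reg \<phi> \<phi>' a b) (u + g) - primal_energy B w f (phi_reg \<phi> \<phi>' a b) (u\<^sub>\<delta> + g) \<le> \<epsilon>"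
    "0 < \<kappa>" "\<kappa> < 1"
    "is_arg_min (dual_energy B w g (phi_reg \<phi> \<phi>' a b)) (\<lambda>\<tau>. \<tau> \<in> dual_feasible B C f) \<sigma>\<^sub>\<delta>"
    "\<forall>\<sigma> u_it n. \<sigma> 0 \<in> dual_feasible B C f \<longrightarrow> dirls_iterates B C w f g (phi_reg \<phi> \<phi>' a b) \<sigma> u_it \<longrightarrow> 1 \<le> n \<longrightarrow>
        (\<Sum>i<M. w i * (V_fun (phi_reg' \<phi>' a b) ((B *\<^sub>v (u + g)) $ i)
            - V_fun (phi_reg' \<phi>' a b) ((B *\<^sub>v (u_it n + g)) $ i))\<^sup>2)
        \<le> 32 * k2 ^ 3 * (\<epsilon> + C\<^sub>\<delta> * (1 - \<kappa>) ^ n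
            * (dual_energy B w g (phi_reg \<phi> \<phi>' a b) (\<sigma> 0) - dual_energy B w g (phi_reg \<phi> \<phi>' a b) \<sigma>\<^sub>\<delta>))"
    using regularized_dirls_estimate[OF hyps(1,2) w hyps(4-8)] by blast
  show "\<exists>(a::real) (b::real) u\<^sub>\<delta>.
      let \<phi>\<^sub>\<delta> = phi_reg \<phi> \<phi>' a b;
          V = V_fun (phi_reg' \<phi>' a b);
          J\<^sub>\<delta> = primal_energy B w f \<phi>\<^sub>\<delta>;
          Jd\<^sub>\<delta> = dual_energy B w g \<phi>\<^sub>\<delta>
      in
        0 < a \<and> a \<le> b \<and>
        is_arg_min (\<lambda>v. J\<^sub>\<delta> (v + g)) (\<lambda>v. v \<in> mat_kernel C) u\<^sub>\<delta> \<and>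
        J\<^sub>\<delta> (u + g) - J\<^sub>\<delta> (u\<^sub>\<delta> + g) \<le> \<epsilon> \<and>
        (\<exists>(\<kappa>::real) (C\<^sub>\<delta>::real) \<sigma>\<^sub>\<delta>.
          0 < \<kappa> \<and> \<kappa> < 1 \<and>
          is_arg_min Jd\<^sub>\<delta> (\<lambda>\<tau>. \<tau> \<in> dual_feasible B C f) \<sigma>\<^sub>\<delta> \<and>
          (\<forall>\<sigma> u_it. \<sigma> 0 \<in> dual_feasible B C f \<and> dirls_iterates B C w f g \<phi>\<^sub>\<delta> \<sigma> u_it \<longrightarrow>
            (\<forall>n\<ge>1.
              (\<Sum>\<alpha><M. w \<alpha> *
                \<bar>V ((B *\<^sub>v (u + g)) $ \<alpha>) - V ((B *\<^sub>v (u_it n + g)) $ \<alpha>)\<bar>\<^sup>2)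
              \<le> 32 * k2 ^ 3 * (\<epsilon> + C\<^sub>\<delta> * (1 - \<kappa>) ^ n * (Jd\<^sub>\<delta> (\<sigma> 0) - Jd\<^sub>\<delta> \<sigma>\<^sub>\<delta>)))))"
    unfolding Let_def power2_abs
    by (rule exI[of _ a], rule exI[of _ b], rule exI[of _ u\<^sub>\<delta>], intro conjI *(1-4),
        rule exI[of _ \<kappa>], rule exI[of _ C\<^sub>\<delta>], rule exI[of _ \<sigma>\<^sub>\<delta>], intro conjI *(5-7))
      (use *(8) in blast)
qed

end
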